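(* Let $d>2$ be an integer and let $\mathscr{T}_d$ be the $d$-regular tree. Fix an integer $N>2d^4+d$. Then for any $\beta>0$ the antiferromagnetic $N$-state Potts model on $\mathscr{T}_d$ at inverse temperature $\beta$ admits a unique realizing Gibbs measure $\mu$, and $\mu$ is $\psi$-mixing with exponential decay rate $$\frac19\ln(N-d)-\frac49\ln d-\frac{\ln2}{9}.$$
   Context: Let $S$ be the vertex set of $\mathscr{T}_d$, write $s\sim t$ for adjacent vertices, and let $d(\cdot,\cdot)$ be the path metric on $S$. Let $E=\{1,\dots,N\}$, $\Omega=E^S$ with the product topology and Borel $\sigma$-algebra $\mathscr{F}$, with coordinate projections $\sigma_s$; for $\Lambda\subseteq S$, $\mathscr{F}_\Lambda$ is the $\sigma$-algebra generated by $\{\sigma_s:s\in\Lambda\}$, and $\sigma_\Lambda(\omega)=\omega_\Lambda$ is the restriction of $\omega$ to $\Lambda$. $\Lambda\sqsubseteq S$ means $\Lambda$ is a finite subset of $S$. For $w_\Lambda\in E^\Lambda$ and $\omega\in\Omega$, $w_\Lambda\omega_{\Lambda^c}$ is the configuration equal to $w_\Lambda$ on $\Lambda$ and to $\omega$ on $\Lambda^c$. The antiferromagnetic $N$-state Potts model at inverse temperature $\beta>0$ is given by the potential $\Psi^\beta=(\Psi^\beta_\Delta)_{\Delta\sqsubseteq S}$ with $\Psi^\beta_\Delta(\omega)=\beta\,\delta(\omega_s,\omega_t)$ if $\Delta=\{s,t\}$ with $s\sim t$ ($\delta$ the Kronecker delta), and $\Psi^\beta_\Delta\equiv0$ otherwise.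 For $\Lambda\sqsubseteq S$ put $H_\Lambda(\omega)=\sum_{\Delta\sqsubseteq S,\ \Delta\cap\Lambda\ne\emptyset}\Psi^\beta_\Delta(\omega)$ and $Z_\Lambda(\omega)=\sum_{w_\Lambda\in E^\Lambda}e^{-H_\Lambda(w_\Lambda\omega_{\Lambda^c})}$. A probability measure $\mu$ on $(\Omega,\mathscr{F})$ is a realizing Gibbs measure if for every $\Lambda\sqsubseteq S$ and $w_\Lambda\in E^\Lambda$, the conditional probability of $\{\sigma_\Lambda=w_\Lambda\}$ given $\mathscr{F}_{\Lambda^c}$ under $\mu$ equals $e^{-H_\Lambda(w_\Lambda\omega_{\Lambda^c})}/Z_\Lambda(\omega)$ for $\mu$-almost every $\omega$. For $U,V\subseteq S$ put $$\psi(U,V)=\sup\left\{\left|\frac{\mu(A\cap B)}{\mu(A)\mu(B)}-1\right|: A\in\mathscr{F}_U,\ B\in\mathscr{F}_V,\ \mu(A)\mu(B)>0\right\},$$ and for $\lambda>0$ put $\Sigma(\lambda,U,V)=\sum_{t\in U}\sum_{s\in V}e^{-\lambda d(t,s)}\in[0,\infty]$. The measure $\mu$ is $\psi$-mixing with exponential decay rate $\lambda$ if there is a constant $C\ge1$ such that $\psi(U,V)\le C\,\Sigma(\lambda,U,V)$ for all $U,V\subseteq S$ with $C\,\Sigma(\lambda,U,V)<1$. *)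

theory Defs
  imports "HOL-Probability.Probability"
begin

text \<open>
  The vertex set \<open>S\<close> is the whole type \<open>'v\<close>, and a simple graph on it is given by its adjacency
  relation. A cycle is a list of at least three distinct vertices, consecutive ones (cyclically)
  being adjacent.
\<close>

definition simple_graph :: "('v \<Rightarrow> 'v \<Rightarrow> bool) \<Rightarrow> bool" where
  "simple_graph adj \<longleftrightarrow> symp adj \<and> irreflp adj"

definition connected_graph :: "('v \<Rightarrow> 'v \<Rightarrow> bool) \<Rightarrow> bool" where
  "connected_graph adj \<longleftrightarrow> (\<forall>s t. adj\<^sup>*\<^sup>* s t)"

definition graph_cycle :: "('v \<Rightarrow> 'v \<Rightarrow> bool) \<Rightarrow> 'v list \<Rightarrow> bool" where
  "graph_cycle adj p \<longleftrightarrow> length p \<ge> 3 \<and> distinct p \<and> successively adj p \<and> adj (last p) (hd p)"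

definition tree_graph :: "('v \<Rightarrow> 'v \<Rightarrow> bool) \<Rightarrow> bool" where
  "tree_graph adj \<longleftrightarrow> simple_graph adj \<and> connected_graph adj \<and> \<not> (\<exists>p. graph_cycle adj p)"

definition regular_tree :: "nat \<Rightarrow> ('v \<Rightarrow> 'v \<Rightarrow> bool) \<Rightarrow> bool" where
  "regular_tree d adj \<longleftrightarrow> tree_graph adj \<and> (\<forall>s. finite {t. adj s t} \<and> card {t. adj s t} = d)"

text \<open>The least length of a walk between two vertices; meaningful for connected graphs.\<close>

definition graph_dist :: "('v \<Rightarrow> 'v \<Rightarrow> bool) \<Rightarrow> 'v \<Rightarrow> 'v \<Rightarrow> nat" where
  "graph_dist adj s t = (LEAST n. (adj ^^ n) s t)"

definition configs :: "nat \<Rightarrow> ('v \<Rightarrow> nat) set" where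
  "configs N = (\<Pi>\<^sub>E s\<in>UNIV. {1..N})"

definition config_topology :: "nat \<Rightarrow> ('v \<Rightarrow> nat) topology" where
  "config_topology N = product_topology (\<lambda>s. discrete_topology {1..N}) UNIV"

definition config_borel :: "nat \<Rightarrow> ('v \<Rightarrow> nat) measure" where
  "config_borel N = sigma (configs N) {U. openin (config_topology N) U}"

definition config_algebra :: "nat \<Rightarrow> 'v set \<Rightarrow> ('v \<Rightarrow> nat) measure" where
  "config_algebra N \<Lambda> = sigma (configs N) {{\<omega> \<in> configs N. \<omega> s \<in> A} | s A. s \<in> \<Lambda> \<and> A \<subseteq> {1..N}}"

definition potts_potential ::
    "('v \<Rightarrow> 'v \<Rightarrow> bool) \<Rightarrow> real \<Rightarrow> 'v set \<Rightarrow> ('v \<Rightarrow> nat) \<Rightarrow> real" where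
  "potts_potential adj \<beta> \<Delta> \<omega> = \<beta> * of_bool (\<exists>s t. \<Delta> = {s, t} \<and> adj s t \<and> \<omega> s = \<omega> t)"

lemma potts_potential_edge:
  assumes "simple_graph adj" "adj s t"
  shows "potts_potential adj \<beta> {s, t} \<omega> = (if \<omega> s = \<omega> t then \<beta> else 0)"
  using assms by (auto simp: potts_potential_def simple_graph_def doubleton_eq_iff)

lemma potts_potential_nonedge:
  assumes "\<nexists>s t. \<Delta> = {s, t} \<and> adj s t"
  shows "potts_potential adj \<beta> \<Delta> \<omega> = 0"
  using assms by (auto simp: potts_potential_def)

text \<open>
  The sum ranges over infinitely many \<open>\<Delta>\<close>; \<open>finite_potts_support\<close> shows that in the
  Potts case only finitely many terms are nonzero.
\<close>

definition hamiltonian ::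
    "('v set \<Rightarrow> ('v \<Rightarrow> nat) \<Rightarrow> real) \<Rightarrow> 'v set \<Rightarrow> ('v \<Rightarrow> nat) \<Rightarrow> real" where
  "hamiltonian \<Psi> \<Lambda> \<omega> = (\<Sum>\<^sub>\<infinity>\<Delta>\<in>{\<Delta>. finite \<Delta> \<and> \<Delta> \<inter> \<Lambda> \<noteq> {}}. \<Psi> \<Delta> \<omega>)"

lemma finite_potts_support:
  assumes "simple_graph adj" "\<And>s. finite {t. adj s t}" "finite \<Lambda>"
  shows "finite {\<Delta>. finite \<Delta> \<and> \<Delta> \<inter> \<Lambda> \<noteq> {} \<and> potts_potential adj \<beta> \<Delta> \<omega> \<noteq> 0}"
proof (rule finite_subset)
  show "finite (\<Union>s\<in>\<Lambda>. (\<lambda>t. {s, t}) ` {t. adj s t})"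
    using assms by auto
  show "{\<Delta>. finite \<Delta> \<and> \<Delta> \<inter> \<Lambda> \<noteq> {} \<and> potts_potential adj \<beta> \<Delta> \<omega> \<noteq> 0}
      \<subseteq> (\<Union>s\<in>\<Lambda>. (\<lambda>t. {s, t}) ` {t. adj s t})"
    using assms(1) by (fastforce simp: potts_potential_def simple_graph_def dest: sympD)
qed

text \<open>
  \<open>override_on \<omega> w \<Lambda>\<close> is the configuration equal to \<open>w\<close> on \<open>\<Lambda>\<close> and to
  \<open>\<omega>\<close> off \<open>\<Lambda>\<close>.
\<close>

definition partition_fun ::
    "nat \<Rightarrow> ('v set \<Rightarrow> ('v \<Rightarrow> nat) \<Rightarrow> real) \<Rightarrow> 'v set \<Rightarrow> ('v \<Rightarrow> nat) \<Rightarrow> real" where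
  "partition_fun N \<Psi> \<Lambda> \<omega> = (\<Sum>w\<in>(\<Pi>\<^sub>E s\<in>\<Lambda>. {1..N}). exp (- hamiltonian \<Psi> \<Lambda> (override_on \<omega> w \<Lambda>)))"

definition realizing_gibbs ::
    "nat \<Rightarrow> ('v set \<Rightarrow> ('v \<Rightarrow> nat) \<Rightarrow> real) \<Rightarrow> ('v \<Rightarrow> nat) measure \<Rightarrow> bool" where
  "realizing_gibbs N \<Psi> \<mu> \<longleftrightarrow>
     prob_space \<mu> \<and> space \<mu> = configs N \<and> sets \<mu> = sets (config_borel N) \<and>
     (\<forall>\<Lambda> w. finite \<Lambda> \<longrightarrow> w \<in> (\<Pi>\<^sub>E s\<in>\<Lambda>. {1..N}) \<longrightarrow>
       (AE \<omega> in \<mu>.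
          real_cond_exp \<mu> (config_algebra N (- \<Lambda>))
            (indicator {\<eta> \<in> configs N. restrict \<eta> \<Lambda> = w}) \<omega>
          = exp (- hamiltonian \<Psi> \<Lambda> (override_on \<omega> w \<Lambda>)) / partition_fun N \<Psi> \<Lambda> \<omega>))"

definition psi_coeff :: "nat \<Rightarrow> ('v \<Rightarrow> nat) measure \<Rightarrow> 'v set \<Rightarrow> 'v set \<Rightarrow> ennreal" where
  "psi_coeff N \<mu> U V =
     Sup {ennreal \<bar>measure \<mu> (A \<inter> B) / (measure \<mu> A * measure \<mu> B) - 1\<bar> | A B.
            A \<in> sets (config_algebra N U) \<and> B \<in> sets (config_algebra N V) \<and>
            measure \<mu> A * measure \<mu> B > 0}"

definition exp_dist_sum ::
    "('v \<Rightarrow> 'v \<Rightarrow> bool) \<Rightarrow> real \<Rightarrow> 'v set \<Rightarrow> 'v set \<Rightarrow> ennreal" where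
  "exp_dist_sum adj r U V =
     (\<Sum>\<^sub>\<infinity>t\<in>U. \<Sum>\<^sub>\<infinity>s\<in>V. ennreal (exp (- r * real (graph_dist adj t s))))"

definition psi_mixing ::
    "('v \<Rightarrow> 'v \<Rightarrow> bool) \<Rightarrow> nat \<Rightarrow> ('v \<Rightarrow> nat) measure \<Rightarrow> real \<Rightarrow> bool" where
  "psi_mixing adj N \<mu> r \<longleftrightarrow>
     r > 0 \<and>
     (\<exists>C::real. C \<ge> 1 \<and>
        (\<forall>U V. ennreal C * exp_dist_sum adj r U V < 1 \<longrightarrow>
           psi_coeff N \<mu> U V \<le> ennreal C * exp_dist_sum adj r U V))"

end

theory Submission
  imports Defs
begin

text \<open>
  Let \<open>\<kappa> = d / (N - d)\<close>. Changing the neighbours of a site \<open>s\<close> arbitrarily moves the conditional law at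
  \<open>s\<close> by at most \<open>\<kappa>\<close> in total variation, because at least \<open>N - d\<close> states have weight 1 and only the at
  most \<open>d\<close> states occurring next to \<open>s\<close> are penalised. Averaging over the neighbours and
  revealing them one by one shows inductively that the law at \<open>s\<close> changes by at most
  \<open>(d\<kappa>)\<^sup>n\<close> if the boundary condition changes only at distance more than \<open>n\<close>; this holds uniformly in the
  finite volume, hence also with further sites frozen. Thus the finite-volume
  Gibbs measures converge, to the unique Gibbs measure. For the mixing bound, Bayes' rule turns the influence of
  \<open>U\<close> on one site \<open>s \<in> V\<close> into a multiplicative change of the conditional probability of an event in
  \<open>U\<close> (single-site probabilities are bounded below), and the errors multiply over \<open>s \<in> V\<close>. The
  claimed rate follows since \<open>d\<kappa> \<le> 2d\<^sup>4 / (N - d) < 1\<close>, so that \<open>d\<kappa>\<close> is at most its own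
  upper bound raised to the power \<open>1/9\<close>.
\<close>

section \<open>Finite-volume Gibbs expectations\<close>

text \<open>\<open>psi_coeff\<close> measures a relative error, whereas the decay of influence is an
  additive bound, useless for an event in \<open>U\<close> of tiny probability. Hence the reversal
  of roles: the probability of a state at one site \<open>s\<close> never falls below
  \<open>p_min\<close>, so there an additive error is a relative one, and Bayes' rule hands the same
  ratio to every event in \<open>U\<close>, however rare. The price \<open>1 / p_min\<close> depends
  on \<open>\<beta>\<close> but not on distances, so it enters the mixing constant and leaves the
  rate alone; a further factor \<open>1 / \<theta>\<close> is paid because only the ball of radius
  one less than the distance avoids \<open>U\<close>.

  The recursion for the influence returns to neighbours after others have been frozen. It is
  therefore proved for all finite volumes and boundary conditions at once, which is why it is
  phrased with the kernel \<open>G\<close> rather than with a measure. Only local functions and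
  cylinder events are sent to infinite volume; general events are reached by approximation in
  measure.\<close>

definition edges_at :: "('v \<Rightarrow> 'v \<Rightarrow> bool) \<Rightarrow> 'v set \<Rightarrow> 'v set set" where
  "edges_at adj \<Lambda> = {{s, t} | s t. s \<in> \<Lambda> \<and> adj s t}"

definition depends_on :: "(('v \<Rightarrow> nat) \<Rightarrow> 'b) \<Rightarrow> 'v set \<Rightarrow> bool" where
  "depends_on f J \<longleftrightarrow> (\<forall>\<omega> \<omega>'. (\<forall>t\<in>J. \<omega> t = \<omega>' t) \<longrightarrow> f \<omega> = f \<omega>')"

lemma depends_onD: "depends_on f J \<Longrightarrow> (\<And>t. t \<in> J \<Longrightarrow> \<omega> t = \<omega>' t) \<Longrightarrow> f \<omega> = f \<omega>'"
  by (auto simp: depends_on_def)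

text \<open>Fubini for spin sums: a configuration on \<open>\<Lambda>\<close> is glued from its
  parts on \<open>\<Lambda> - \<Lambda>'\<close> and \<open>\<Lambda>'\<close>. The overrides are
  nested so that the inner sum is a finite-volume sum on \<open>\<Lambda>'\<close> whose boundary
  condition is the configuration already overridden.\<close>

lemma sum_PiE_split:
  fixes F :: "('v \<Rightarrow> nat) \<Rightarrow> real"
  assumes "\<Lambda>' \<subseteq> \<Lambda>"
  shows "(\<Sum>w\<in>PiE \<Lambda> (\<lambda>_. E). F (override_on \<omega> w \<Lambda>)) =
    (\<Sum>u\<in>PiE (\<Lambda> - \<Lambda>') (\<lambda>_. E). \<Sum>v\<in>PiE \<Lambda>' (\<lambda>_. E).
       F (override_on (override_on \<omega> u (\<Lambda> - \<Lambda>')) v \<Lambda>'))"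
  unfolding sum.cartesian_product
proof (rule sum.reindex_bij_witness[where
      j = "\<lambda>w. (restrict w (\<Lambda> - \<Lambda>'), restrict w \<Lambda>')" and
      i = "\<lambda>(u, v). override_on u v \<Lambda>'"], goal_cases)
  case (1 w)
  then show ?case using assms
    by (auto simp: fun_eq_iff override_on_def PiE_def extensional_def)
next
  case (2 w)
  then show ?case using assms by auto
next
  case (3 p)
  then show ?case by (auto simp: fun_eq_iff override_on_def PiE_def extensional_def)
next
  case (4 p)
  then show ?case using assms
    by (auto simp: override_on_def PiE_def extensional_def Pi_def)
next
  case (5 w)
  have "override_on (override_on \<omega> (restrict w (\<Lambda> - \<Lambda>')) (\<Lambda> - \<Lambda>')) (restrict w \<Lambda>') \<Lambda>'
      = override_on \<omega> w \<Lambda>"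
    using assms by (auto simp: fun_eq_iff override_on_def)
  then show ?case by simp
qed

locale potts =
  fixes adj :: "'v \<Rightarrow> 'v \<Rightarrow> bool" and d N :: nat and \<beta> :: real
  assumes d_pos: "d > 0"
    and graph: "simple_graph adj"
    and finite_nbrs: "\<And>s. finite {t. adj s t}"
    and card_nbrs: "\<And>s. card {t. adj s t} = d"
    and many_states: "N > d"
    and \<beta>_pos: "\<beta> > 0"
begin

abbreviation H where "H \<equiv> hamiltonian (potts_potential adj \<beta>)"
abbreviation Z where "Z \<equiv> partition_fun N (potts_potential adj \<beta>)"
abbreviation cfg where "cfg \<Lambda> \<equiv> \<Pi>\<^sub>E s\<in>\<Lambda>. {1..N}"

text \<open>The Gibbs specification as an operator on functions. Its value is again a function of
  the boundary condition, so that successive conditioning becomes composition of kernels.\<close>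

definition G :: "'v set \<Rightarrow> (('v \<Rightarrow> nat) \<Rightarrow> real) \<Rightarrow> ('v \<Rightarrow> nat) \<Rightarrow> real" where
  "G \<Lambda> f \<omega> =
    (\<Sum>w\<in>cfg \<Lambda>. exp (- H \<Lambda> (override_on \<omega> w \<Lambda>)) * f (override_on \<omega> w \<Lambda>)) / Z \<Lambda> \<omega>"

section \<open>Edges and the energy of a finite volume\<close>

lemma adj_sym: "adj s t \<Longrightarrow> adj t s"
  using graph by (auto simp: simple_graph_def dest: sympD)

lemma adj_irrefl: "\<not> adj s s"
  using graph by (auto simp: simple_graph_def dest: irreflpD)

lemma finite_edges_at: "finite \<Lambda> \<Longrightarrow> finite (edges_at adj \<Lambda>)"
proof -
  assume "finite \<Lambda>"
  have "edges_at adj \<Lambda> = (\<Union>s\<in>\<Lambda>. (\<lambda>t. {s, t}) ` {t. adj s t})"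
    by (auto simp: edges_at_def)
  with \<open>finite \<Lambda>\<close> show ?thesis by (simp add: finite_nbrs)
qed

lemma edges_at_outside:
  assumes "\<Delta> \<in> edges_at adj \<Lambda> - edges_at adj \<Lambda>'"
  shows "\<Delta> \<inter> \<Lambda>' = {}"
  using assms adj_sym unfolding edges_at_def by (auto simp: doubleton_eq_iff)

text \<open>The potential vanishes off the edges, and symmetry of adjacency lets every edge that
  meets \<open>\<Lambda>\<close> be written with its first endpoint in \<open>\<Lambda>\<close>.
  From here on the energy is a finite sum.\<close>

lemma hamiltonian_eq_sum:
  assumes "finite \<Lambda>"
  shows "H \<Lambda> \<omega> = (\<Sum>\<Delta>\<in>edges_at adj \<Lambda>. potts_potential adj \<beta> \<Delta> \<omega>)"
proof -
  have "H \<Lambda> \<omega> = infsum (\<lambda>\<Delta>. potts_potential adj \<beta> \<Delta> \<omega>) (edges_at adj \<Lambda>)"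
    unfolding hamiltonian_def
  proof (rule infsum_cong_neutral)
    fix \<Delta> assume "\<Delta> \<in> edges_at adj \<Lambda> - {\<Delta>. finite \<Delta> \<and> \<Delta> \<inter> \<Lambda> \<noteq> {}}"
    then show "potts_potential adj \<beta> \<Delta> \<omega> = 0" by (auto simp: edges_at_def)
  next
    fix \<Delta> assume *: "\<Delta> \<in> {\<Delta>. finite \<Delta> \<and> \<Delta> \<inter> \<Lambda> \<noteq> {}} - edges_at adj \<Lambda>"
    show "potts_potential adj \<beta> \<Delta> \<omega> = 0"
    proof (rule potts_potential_nonedge, clarify)
      fix s t assume "\<Delta> = {s, t}" "adj s t"
      with * adj_sym show False by (auto simp: edges_at_def doubleton_eq_iff)
    qed
  qed auto
  with assms show ?thesis by (simp add: finite_edges_at)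
qed

lemma potts_potential_cong:
  assumes "\<And>t. t \<in> \<Delta> \<Longrightarrow> \<omega> t = \<omega>' t"
  shows "potts_potential adj \<beta> \<Delta> \<omega> = potts_potential adj \<beta> \<Delta> \<omega>'"
  unfolding potts_potential_def
  by (intro arg_cong[of _ _ "\<lambda>b. \<beta> * of_bool b"] ex_cong1 conj_cong refl) (use assms in auto)

text \<open>The remainder \<open>r\<close> collects the edges that touch \<open>\<Lambda>\<close>
  but not \<open>\<Lambda>'\<close>. It stays constant while \<open>\<Lambda>'\<close> is resampled,
  which is what makes the kernels consistent in \<open>G_comp\<close>.\<close>

lemma hamiltonian_split:
  assumes "finite \<Lambda>" "\<Lambda>' \<subseteq> \<Lambda>"
  obtains r where "\<And>\<omega>. H \<Lambda> \<omega> = H \<Lambda>' \<omega> + r \<omega>" "depends_on r (- \<Lambda>')"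
proof
  let ?r = "\<lambda>\<omega>. \<Sum>\<Delta>\<in>edges_at adj \<Lambda> - edges_at adj \<Lambda>'. potts_potential adj \<beta> \<Delta> \<omega>"
  have fin: "finite \<Lambda>'" using assms finite_subset by auto
  show "H \<Lambda> \<omega> = H \<Lambda>' \<omega> + ?r \<omega>" for \<omega>
    unfolding hamiltonian_eq_sum[OF assms(1)] hamiltonian_eq_sum[OF fin]
    by (subst add.commute, intro sum.subset_diff finite_edges_at assms)
      (use assms in \<open>auto simp: edges_at_def\<close>)
  show "depends_on ?r (- \<Lambda>')"
    unfolding depends_on_def
    by (intro allI impI sum.cong potts_potential_cong refl) (use edges_at_outside in blast)
qed

section \<open>The Gibbs kernel as a positive, normalised linear operator\<close>

lemma cfg_nonempty: "cfg \<Lambda> \<noteq> {}"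
  using many_states by (auto simp: PiE_eq_empty_iff)

lemma finite_cfg: "finite \<Lambda> \<Longrightarrow> finite (cfg \<Lambda>)"
  by (simp add: finite_PiE)

lemma Z_pos: "finite \<Lambda> \<Longrightarrow> Z \<Lambda> \<omega> > 0"
  unfolding partition_fun_def using cfg_nonempty by (intro sum_pos finite_cfg) auto

lemma G_const: "finite \<Lambda> \<Longrightarrow> G \<Lambda> (\<lambda>_. k) \<omega> = k"
  using Z_pos[of \<Lambda> \<omega>] by (simp add: G_def sum_distrib_right[symmetric] partition_fun_def)

lemma G_cmult: "G \<Lambda> (\<lambda>\<eta>. k * f \<eta>) \<omega> = k * G \<Lambda> f \<omega>"
  by (simp add: G_def sum_distrib_left mult_ac)

lemma G_add: "G \<Lambda> (\<lambda>\<eta>. f \<eta> + g \<eta>) \<omega> = G \<Lambda> f \<omega> + G \<Lambda> g \<omega>"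
  by (simp add: G_def sum.distrib add_divide_distrib algebra_simps)

lemma G_sum: "G \<Lambda> (\<lambda>\<eta>. \<Sum>i\<in>I. f i \<eta>) \<omega> = (\<Sum>i\<in>I. G \<Lambda> (f i) \<omega>)"
  unfolding G_def sum_distrib_left by (subst sum.swap) (simp add: sum_divide_distrib)

lemma G_cong:
  assumes "\<And>w. w \<in> cfg \<Lambda> \<Longrightarrow> f (override_on \<omega> w \<Lambda>) = g (override_on \<omega> w \<Lambda>)"
  shows "G \<Lambda> f \<omega> = G \<Lambda> g \<omega>"
  using assms by (simp add: G_def)

lemma G_mono:
  assumes "finite \<Lambda>"
    and "\<And>w. w \<in> cfg \<Lambda> \<Longrightarrow> f (override_on \<omega> w \<Lambda>) \<le> g (override_on \<omega> w \<Lambda>)"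
  shows "G \<Lambda> f \<omega> \<le> G \<Lambda> g \<omega>"
  unfolding G_def using Z_pos[OF assms(1), of \<omega>] assms(2)
  by (intro divide_right_mono sum_mono mult_left_mono) auto

lemma G_le:
  assumes "finite \<Lambda>" and "\<And>w. w \<in> cfg \<Lambda> \<Longrightarrow> f (override_on \<omega> w \<Lambda>) \<le> k"
  shows "G \<Lambda> f \<omega> \<le> k"
  using G_mono[OF assms(1), of f \<omega> "\<lambda>_. k"] assms by (simp add: G_const)

lemma G_ge:
  assumes "finite \<Lambda>" and "\<And>w. w \<in> cfg \<Lambda> \<Longrightarrow> k \<le> f (override_on \<omega> w \<Lambda>)"
  shows "k \<le> G \<Lambda> f \<omega>"
  using G_mono[OF assms(1), of "\<lambda>_. k" \<omega> f] assms by (simp add: G_const)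

lemma G_pull_out:
  assumes "\<And>w. w \<in> cfg \<Lambda> \<Longrightarrow> g (override_on \<omega> w \<Lambda>) = g \<omega>"
  shows "G \<Lambda> (\<lambda>\<eta>. g \<eta> * f \<eta>) \<omega> = g \<omega> * G \<Lambda> f \<omega>"
  unfolding G_cmult[symmetric] by (rule G_cong) (simp add: assms)

lemma G_agree:
  assumes "\<And>t. t \<notin> \<Lambda> \<Longrightarrow> \<omega> t = \<omega>' t"
  shows "G \<Lambda> f \<omega> = G \<Lambda> f \<omega>'"
proof -
  have "override_on \<omega> w \<Lambda> = override_on \<omega>' w \<Lambda>" for w
    using assms by (auto simp: override_on_def)
  then show ?thesis by (simp add: G_def partition_fun_def)
qed

lemma G_override: "G \<Lambda> f (override_on \<omega> w \<Lambda>) = G \<Lambda> f \<omega>"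
  by (rule G_agree) simp

text \<open>For a fixed configuration off \<open>\<Lambda>'\<close> the weights of the two volumes
  differ by a constant factor, so averaging \<open>f\<close> over \<open>\<Lambda>'\<close> first
  leaves the weighted sum unchanged. This is the tower property on which all conditioning below
  rests.\<close>

lemma G_comp:
  assumes "finite \<Lambda>" "\<Lambda>' \<subseteq> \<Lambda>"
  shows "G \<Lambda> (G \<Lambda>' f) \<omega> = G \<Lambda> f \<omega>"
proof -
  obtain r where r: "\<And>\<omega>. H \<Lambda> \<omega> = H \<Lambda>' \<omega> + r \<omega>" "depends_on r (- \<Lambda>')"
    using hamiltonian_split[OF assms] by blast
  have fin: "finite \<Lambda>'" using assms finite_subset by auto
  have ro: "r (override_on \<zeta> v \<Lambda>') = r \<zeta>" for \<zeta> v
    using r(2) by (rule depends_onD) auto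
  \<comment> \<open>Unnormalised form with the outer configuration \<open>\<zeta>\<close> frozen:
    summing the weights produces \<open>Z \<Lambda>' \<zeta>\<close>, which cancels the denominator
    of \<open>G \<Lambda>' f\<close>.\<close>
  have inner: "(\<Sum>v\<in>cfg \<Lambda>'. exp (- H \<Lambda> (override_on \<zeta> v \<Lambda>')) * G \<Lambda>' f (override_on \<zeta> v \<Lambda>')) =
      (\<Sum>v\<in>cfg \<Lambda>'. exp (- H \<Lambda> (override_on \<zeta> v \<Lambda>')) * f (override_on \<zeta> v \<Lambda>'))" for \<zeta>
  proof -
    have "(\<Sum>v\<in>cfg \<Lambda>'. exp (- H \<Lambda> (override_on \<zeta> v \<Lambda>')) * G \<Lambda>' f (override_on \<zeta> v \<Lambda>')) =
        exp (- r \<zeta>) * (Z \<Lambda>' \<zeta> * G \<Lambda>' f \<zeta>)"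
      by (simp add: r(1) ro exp_add exp_minus exp_diff G_override partition_fun_def
          sum_distrib_left sum_distrib_right divide_simps mult.commute)
    also have "Z \<Lambda>' \<zeta> * G \<Lambda>' f \<zeta> =
        (\<Sum>w\<in>cfg \<Lambda>'. exp (- H \<Lambda>' (override_on \<zeta> w \<Lambda>')) * f (override_on \<zeta> w \<Lambda>'))"
      unfolding G_def using Z_pos[OF fin, of \<zeta>] by simp
    also have "exp (- r \<zeta>) * \<dots> =
        (\<Sum>v\<in>cfg \<Lambda>'. exp (- H \<Lambda> (override_on \<zeta> v \<Lambda>')) * f (override_on \<zeta> v \<Lambda>'))"
      by (simp add: r(1) ro exp_add exp_minus exp_diff sum_distrib_left divide_simps mult.commute)
    finally show ?thesis .
  qed
  show ?thesis
    unfolding G_def[of \<Lambda>]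
      sum_PiE_split[OF assms(2), of "\<lambda>\<eta>. exp (- H \<Lambda> \<eta>) * f \<eta>" \<omega> "{1..N}"]
      sum_PiE_split[OF assms(2), of "\<lambda>\<eta>. exp (- H \<Lambda> \<eta>) * G \<Lambda>' f \<eta>" \<omega> "{1..N}"]
      inner ..
qed

lemma G_single:
  "G {s} f \<omega> = (\<Sum>c\<in>{1..N}. exp (- H {s} (\<omega> (s := c))) * f (\<omega> (s := c))) /
     (\<Sum>c\<in>{1..N}. exp (- H {s} (\<omega> (s := c))))"
proof -
  have *: "(\<Sum>w\<in>cfg {s}. F (override_on \<omega> w {s})) = (\<Sum>c\<in>{1..N}. F (\<omega> (s := c)))"
    for F :: "_ \<Rightarrow> real"
  \<comment> \<open>Elements of \<open>cfg {s}\<close> are extensional, so the inverse map has to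
    put \<open>undefined\<close> at all other sites.\<close>
  proof (rule sum.reindex_bij_witness[where j = "\<lambda>w. w s" and i = "\<lambda>c. (\<lambda>_. undefined)(s := c)"])
    fix w assume "w \<in> cfg {s}"
    then show "(\<lambda>_. undefined)(s := w s) = w" by (auto simp: PiE_def extensional_def)
  next
    fix w :: "'v \<Rightarrow> nat"
    have "override_on \<omega> w {s} = \<omega> (s := w s)" by (auto simp: override_on_def)
    then show "F (\<omega> (s := w s)) = F (override_on \<omega> w {s})" by simp
  next
    fix c assume "c \<in> {1..N}"
    then show "(\<lambda>_. undefined)(s := c) \<in> cfg {s}" by (auto simp: PiE_def extensional_def)
  qed auto
  show ?thesis unfolding G_def partition_fun_def
    using *[of "\<lambda>\<eta>. exp (- H {s} \<eta>) * f \<eta>"] *[of "\<lambda>\<eta>. exp (- H {s} \<eta>)"] by simp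
qed

section \<open>Energy and conditional law at a single site\<close>

definition occ :: "'v \<Rightarrow> ('v \<Rightarrow> nat) \<Rightarrow> nat \<Rightarrow> nat" where
  "occ s \<omega> c = card {t. adj s t \<and> \<omega> t = c}"

lemma hamiltonian_single: "H {s} (\<omega> (s := c)) = \<beta> * occ s \<omega> c"
proof -
  have "edges_at adj {s} = (\<lambda>t. {s, t}) ` {t. adj s t}" by (auto simp: edges_at_def)
  moreover have "inj_on (\<lambda>t. {s, t}) {t. adj s t}" by (auto simp: inj_on_def doubleton_eq_iff)
  ultimately have "H {s} (\<omega> (s := c)) =
      (\<Sum>t\<in>{t. adj s t}. potts_potential adj \<beta> {s, t} (\<omega> (s := c)))"
    by (simp add: hamiltonian_eq_sum sum.reindex)
  \<comment> \<open>No vertex is its own neighbour, so the update at \<open>s\<close> leaves all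
    neighbouring states as they were.\<close>
  also have "\<dots> = (\<Sum>t\<in>{t. adj s t}. if \<omega> t = c then \<beta> else 0)"
    using adj_irrefl by (intro sum.cong) (auto simp: potts_potential_edge[OF graph])
  also have "\<dots> = \<beta> * occ s \<omega> c"
    by (simp add: sum.If_cases finite_nbrs occ_def Int_def)
  finally show ?thesis .
qed

end

section \<open>Decay of influence\<close>

context potts begin

lemma occ_cong: "(\<And>t. adj s t \<Longrightarrow> \<omega> t = \<omega>' t) \<Longrightarrow> occ s \<omega> c = occ s \<omega>' c"
  unfolding occ_def by (intro arg_cong[of _ _ card]) auto

lemma occ_le: "occ s \<omega> c \<le> d"
  using card_mono[OF finite_nbrs[of s], of "{t. adj s t \<and> \<omega> t = c}"] card_nbrs[of s]
  by (auto simp: occ_def)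

lemma card_occupied: "finite {c. occ s \<omega> c \<noteq> 0} \<and> card {c. occ s \<omega> c \<noteq> 0} \<le> d"
proof -
  have sub: "{c. occ s \<omega> c \<noteq> 0} \<subseteq> \<omega> ` {t. adj s t}"
  proof
    fix c assume "c \<in> {c. occ s \<omega> c \<noteq> 0}"
    then have "card {t. adj s t \<and> \<omega> t = c} \<noteq> 0" by (simp add: occ_def)
    then obtain t where "t \<in> {t. adj s t \<and> \<omega> t = c}"
      by (metis card.empty equals0I)
    then show "c \<in> \<omega> ` {t. adj s t}" by blast
  qed
  have fin: "finite (\<omega> ` {t. adj s t})" using finite_nbrs by (rule finite_imageI)
  have "card {c. occ s \<omega> c \<noteq> 0} \<le> card (\<omega> ` {t. adj s t})" using fin sub by (rule card_mono)
  also have "\<dots> \<le> d" unfolding card_nbrs[of s, symmetric] using finite_nbrs by (rule card_image_le)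
  finally show ?thesis using finite_subset[OF sub fin] by (rule conjI[rotated])
qed

definition site_prob :: "'v \<Rightarrow> ('v \<Rightarrow> nat) \<Rightarrow> nat \<Rightarrow> real" where
  "site_prob s \<omega> c = exp (- \<beta> * occ s \<omega> c) / (\<Sum>c\<in>{1..N}. exp (- \<beta> * occ s \<omega> c))"

lemma G_single_site_prob: "G {s} f \<omega> = (\<Sum>c\<in>{1..N}. site_prob s \<omega> c * f (\<omega> (s := c)))"
  by (simp add: G_single hamiltonian_single site_prob_def sum_divide_distrib)

lemma site_weights_ge: "real N - real d \<le> (\<Sum>c\<in>{1..N}. exp (- \<beta> * occ s \<omega> c))"
proof -
  let ?O = "{c. occ s \<omega> c \<noteq> 0}"
  have "real N - real d \<le> real (card ({1..N} - ?O))"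
    using diff_card_le_card_Diff[of ?O "{1..N}"] card_occupied[of s \<omega>] many_states by simp linarith
  also have "\<dots> = (\<Sum>c\<in>{1..N} - ?O. exp (- \<beta> * occ s \<omega> c))"
    by simp
  also have "\<dots> \<le> (\<Sum>c\<in>{1..N}. exp (- \<beta> * occ s \<omega> c))"
    by (rule sum_mono2) auto
  finally show ?thesis .
qed

lemma site_weights_pos: "(\<Sum>c\<in>{1..N}. exp (- \<beta> * occ s \<omega> c)) > 0"
  using site_weights_ge[of s \<omega>] many_states by linarith

lemma site_prob_pos: "site_prob s \<omega> c > 0"
  unfolding site_prob_def using site_weights_pos by simp

lemma sum_site_prob: "(\<Sum>c\<in>{1..N}. site_prob s \<omega> c) = 1"
  unfolding site_prob_def sum_divide_distrib[symmetric] using site_weights_pos[of s \<omega>] by simp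

lemma site_prob_le: "site_prob s \<omega> c \<le> 1 / (real N - real d)"
  unfolding site_prob_def using site_weights_ge[of s \<omega>] \<beta>_pos many_states
  by (intro frac_le) auto

text \<open>A weight is at least \<open>exp (- \<beta> * d)\<close> because \<open>occ\<close> is at
  most \<open>d\<close>, and the normalisation is at most \<open>N\<close>. This is the only
  quantitative bound in which \<open>\<beta>\<close> survives.\<close>

definition p_min :: real where "p_min = exp (- \<beta> * d) / N"

lemma p_min_pos: "p_min > 0"
  using many_states by (simp add: p_min_def)

lemma site_prob_ge: "p_min \<le> site_prob s \<omega> c"
proof -
  have "(\<Sum>c\<in>{1..N}. exp (- \<beta> * occ s \<omega> c)) \<le> (\<Sum>c\<in>{1..N}. 1)"
    using \<beta>_pos by (intro sum_mono) auto
  then show ?thesis unfolding p_min_def site_prob_def using site_weights_pos[of s \<omega>] \<beta>_pos occ_le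
    by (intro frac_le) auto
qed

text \<open>
  If the normalisation at \<open>\<omega>\<close> is the larger one, the law at \<open>\<omega>\<close> can exceed the one at \<open>\<omega>'\<close>
  only at the at most \<open>d\<close> states seen from \<open>s\<close> in \<open>\<omega>'\<close>.
\<close>

lemma site_prob_diff_aux:
  assumes "(\<Sum>c\<in>{1..N}. exp (- \<beta> * occ s \<omega>' c)) \<le> (\<Sum>c\<in>{1..N}. exp (- \<beta> * occ s \<omega> c))"
    and h: "\<And>c. 0 \<le> h c \<and> h c \<le> 1"
  shows "(\<Sum>c\<in>{1..N}. (site_prob s \<omega> c - site_prob s \<omega>' c) * h c) \<le> d / (real N - real d)"
proof -
  let ?O = "{c. occ s \<omega>' c \<noteq> 0}"
  \<comment> \<open>A state not seen in \<open>\<omega>'\<close> has weight 1 there, at least its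
    weight at \<open>\<omega>\<close>, and is divided by a normalisation no larger than the one at
    \<open>\<omega>\<close>.\<close>
  have neg: "site_prob s \<omega> c \<le> site_prob s \<omega>' c" if "c \<notin> ?O" for c
    using that assms(1) \<beta>_pos site_weights_pos[of s \<omega>'] unfolding site_prob_def
    by (intro frac_le) auto
  have "(\<Sum>c\<in>{1..N}. (site_prob s \<omega> c - site_prob s \<omega>' c) * h c)
      \<le> (\<Sum>c\<in>{1..N}. if c \<in> ?O then 1 / (real N - real d) else 0)"
  proof (rule sum_mono)
    fix c
    show "(site_prob s \<omega> c - site_prob s \<omega>' c) * h c \<le> (if c \<in> ?O then 1 / (real N - real d) else 0)"
    proof (cases "c \<in> ?O")
      case True
      have "(site_prob s \<omega> c - site_prob s \<omega>' c) * h c \<le> site_prob s \<omega> c * 1"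
        using site_prob_pos[of s \<omega> c] site_prob_pos[of s \<omega>' c] h[of c]
        by (intro mult_mono) auto
      with site_prob_le[of s \<omega> c] True show ?thesis by simp
    next
      case False
      with neg[of c] h[of c] show ?thesis by (simp add: mult_nonpos_nonneg)
    qed
  qed
  also have "\<dots> = card ({1..N} \<inter> ?O) * (1 / (real N - real d))"
    by (simp add: sum.If_cases)
  also have "\<dots> \<le> d * (1 / (real N - real d))"
  proof (rule mult_right_mono)
    show "real (card ({1..N} \<inter> ?O)) \<le> real d"
      using card_occupied[of s \<omega>'] card_mono[of ?O "{1..N} \<inter> ?O"] by auto
  qed (use many_states in simp)
  finally show ?thesis by simp
qed

text \<open>The auxiliary bound needs the larger normalisation at the first argument. In the other
  case the roles are exchanged and \<open>h\<close> is replaced by \<open>1 - h\<close>; since both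
  laws have total mass 1, this gives the same difference.\<close>

lemma site_prob_diff:
  assumes h: "\<And>c. 0 \<le> h c \<and> h c \<le> 1"
  shows "(\<Sum>c\<in>{1..N}. site_prob s \<omega> c * h c) - (\<Sum>c\<in>{1..N}. site_prob s \<omega>' c * h c)
    \<le> d / (real N - real d)"
proof (cases "(\<Sum>c\<in>{1..N}. exp (- \<beta> * occ s \<omega>' c)) \<le> (\<Sum>c\<in>{1..N}. exp (- \<beta> * occ s \<omega> c))")
  case True
  from site_prob_diff_aux[OF this h] show ?thesis
    by (simp add: left_diff_distrib sum_subtractf)
next
  case False
  then have "(\<Sum>c\<in>{1..N}. (site_prob s \<omega>' c - site_prob s \<omega> c) * (1 - h c)) \<le> d / (real N - real d)"
    using h by (intro site_prob_diff_aux) auto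
  then show ?thesis
    by (simp add: algebra_simps sum_subtractf sum.distrib sum_site_prob[simplified])
qed

section \<open>Propagation of a change in the boundary condition\<close>

lemma G_bounds:
  assumes "finite \<Lambda>" "\<And>\<omega>. l \<le> f \<omega> \<and> f \<omega> \<le> u"
  shows "l \<le> G \<Lambda> f \<omega> \<and> G \<Lambda> f \<omega> \<le> u"
  using assms by (auto intro: G_le G_ge)

text \<open>Conditioning on the state at \<open>u\<close>: once it is revealed, the inner kernel
  sees only the original boundary condition together with that state, so the outer average involves
  \<open>\<eta>\<close> through \<open>\<eta> u\<close> alone.\<close>

lemma G_insert_site:
  assumes "finite \<Lambda>" "u \<in> \<Lambda>"
  shows "G \<Lambda> f \<omega> = G \<Lambda> (\<lambda>\<eta>. G (\<Lambda> - {u}) f (\<omega> (u := \<eta> u))) \<omega>"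
proof -
  have "G \<Lambda> f \<omega> = G \<Lambda> (G (\<Lambda> - {u}) f) \<omega>"
    using assms by (subst G_comp) auto
  also have "\<dots> = G \<Lambda> (\<lambda>\<eta>. G (\<Lambda> - {u}) f (\<omega> (u := \<eta> u))) \<omega>"
    by (intro G_cong G_agree) auto
  finally show ?thesis .
qed

text \<open>
  Reveal the sites of \<open>J\<close> one at a time: as long as the revealed values agree under both boundary
  conditions, these still differ only on \<open>D\<close>.
\<close>

lemma influence_joint:
  fixes L \<delta> l :: real
  assumes fin: "finite \<Lambda>" "finite J" and L: "L \<ge> 0" and \<delta>: "\<delta> \<ge> 0"
    and g: "depends_on g J" "\<And>\<omega>. l \<le> g \<omega> \<and> g \<omega> \<le> l + L" and D: "J \<inter> D \<subseteq> \<Lambda>" "D \<inter> \<Lambda> = {}"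
    and agree: "\<And>t. t \<notin> \<Lambda> \<union> D \<Longrightarrow> \<omega> t = \<omega>' t"
    and single: "\<And>u \<Lambda>' h \<omega> \<omega>'. u \<in> J \<Longrightarrow> \<Lambda>' \<subseteq> \<Lambda> \<Longrightarrow> (\<And>c. 0 \<le> h c \<and> h c \<le> (1::real)) \<Longrightarrow>
      (\<And>t. t \<notin> \<Lambda>' \<union> D \<Longrightarrow> \<omega> t = \<omega>' t) \<Longrightarrow>
      G \<Lambda>' (\<lambda>\<eta>. h (\<eta> u)) \<omega> - G \<Lambda>' (\<lambda>\<eta>. h (\<eta> u)) \<omega>' \<le> \<delta>"
  shows "G \<Lambda> g \<omega> - G \<Lambda> g \<omega>' \<le> card (J \<inter> \<Lambda>) * (L * \<delta>)"
proof -
  have "finite (J \<inter> \<Lambda>)" using fin by simp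
  \<comment> \<open>The volume must vary in the induction, because a revealed site leaves it; for
    this reason \<open>single\<close> is assumed in every subvolume of
    \<open>\<Lambda>\<close>.\<close>
  moreover have "J \<inter> \<Lambda> = K \<Longrightarrow> ?thesis" if "finite K" for K
    using that fin(1) D agree single
  proof (induction K arbitrary: \<Lambda> \<omega> \<omega>' rule: finite_induct)
    case empty
    have "G \<Lambda> g \<omega> = g \<omega>" for \<omega>
    proof -
      have "g (override_on \<omega> w \<Lambda>) = g \<omega>" for w
        using g(1) by (rule depends_onD) (use empty(1) in \<open>auto simp: override_on_def\<close>)
      with G_pull_out[of \<Lambda> g \<omega> "\<lambda>_. 1"] empty(2) show ?thesis by (simp add: G_const)
    qed
    moreover have "g \<omega> = g \<omega>'"
      using g(1) by (rule depends_onD) (use empty in blast)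
    ultimately show ?case using empty.prems by simp
  next
    case (insert u K)
    let ?\<Lambda> = "\<Lambda> - {u}"
    have u: "u \<in> J" "u \<in> \<Lambda>" using insert.prems(1) by auto
    define k where "k \<omega> c = G ?\<Lambda> g (\<omega> (u := c))" for \<omega> c
    have k: "l \<le> k \<omega> c \<and> k \<omega> c \<le> l + L" for \<omega> c
      unfolding k_def using insert.prems(2) g(2) by (intro G_bounds) auto
    have eq: "G \<Lambda> g \<omega> = G \<Lambda> (\<lambda>\<eta>. k \<omega> (\<eta> u)) \<omega>" for \<omega>
      unfolding k_def using insert.prems(2) u by (intro G_insert_site)
    have kk: "k \<omega> c \<le> k \<omega>' c + card K * (L * \<delta>)" for c
    proof -
      have JK: "J \<inter> ?\<Lambda> = K" using insert by auto
      have "G ?\<Lambda> g (\<omega> (u := c)) - G ?\<Lambda> g (\<omega>' (u := c)) \<le> card (J \<inter> ?\<Lambda>) * (L * \<delta>)"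
      proof (rule insert.IH[OF JK])
        show "J \<inter> D \<subseteq> ?\<Lambda>" using insert.prems(3,4) u by auto
        fix v \<Lambda>' and h :: "nat \<Rightarrow> real" and \<zeta> \<zeta>' :: "'v \<Rightarrow> nat"
        assume "v \<in> J" "\<Lambda>' \<subseteq> ?\<Lambda>" "\<And>c. 0 \<le> h c \<and> h c \<le> (1::real)" "\<And>t. t \<notin> \<Lambda>' \<union> D \<Longrightarrow> \<zeta> t = \<zeta>' t"
        then show "G \<Lambda>' (\<lambda>\<eta>. h (\<eta> v)) \<zeta> - G \<Lambda>' (\<lambda>\<eta>. h (\<eta> v)) \<zeta>' \<le> \<delta>"
          by (intro insert.prems(6)) auto
      qed (use insert.prems in auto)
      with JK show ?thesis unfolding k_def by simp
    qed
    \<comment> \<open>The difference is split in two: exchanging the integrand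
      \<open>k \<omega>\<close> for \<open>k \<omega>'\<close> costs the inductive bound, and
      exchanging the law of the state at \<open>u\<close> costs one further
      \<open>L * \<delta>\<close>.\<close>
    have "G \<Lambda> (\<lambda>\<eta>. k \<omega> (\<eta> u)) \<omega>' \<le> G \<Lambda> (\<lambda>\<eta>. k \<omega>' (\<eta> u) + card K * (L * \<delta>)) \<omega>'"
      by (rule G_mono[OF insert.prems(2) kk])
    also have "\<dots> = G \<Lambda> g \<omega>' + card K * (L * \<delta>)"
      unfolding eq[of \<omega>'] G_add G_const[OF insert.prems(2)] ..
    finally have 1: "G \<Lambda> (\<lambda>\<eta>. k \<omega> (\<eta> u)) \<omega>' \<le> G \<Lambda> g \<omega>' + card K * (L * \<delta>)" .
    have 2: "G \<Lambda> (\<lambda>\<eta>. k \<omega> (\<eta> u)) \<omega> - G \<Lambda> (\<lambda>\<eta>. k \<omega> (\<eta> u)) \<omega>' \<le> L * \<delta>"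
    proof (cases "L = 0")
      case True
      with k[of \<omega>] have "k \<omega> c = l" for c by (simp add: order_antisym)
      then show ?thesis using True insert.prems(2) by (simp add: G_const)
    next
      case False
      \<comment> \<open>Rescaling to the unit interval, the range for which \<open>single\<close> is
        assumed; hence the separate treatment of \<open>L = 0\<close>.\<close>
      define h where "h c = (k \<omega> c - l) / L" for c
      have kh: "k \<omega> c = L * h c + l" for c using False by (simp add: h_def)
      have "0 \<le> h c \<and> h c \<le> 1" for c
        using k[of \<omega> c] L False by (auto simp: h_def divide_simps)
      then have "G \<Lambda> (\<lambda>\<eta>. h (\<eta> u)) \<omega> - G \<Lambda> (\<lambda>\<eta>. h (\<eta> u)) \<omega>' \<le> \<delta>"
        using insert.prems u by (intro insert.prems(6)) auto
      from mult_left_mono[OF this L] show ?thesis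
        unfolding kh G_add G_cmult G_const[OF insert.prems(2)] by (simp add: algebra_simps)
    qed
    have "card (J \<inter> \<Lambda>) = Suc (card K)" using insert by simp
    with 1 2 show ?case unfolding eq[of \<omega>] by (simp add: algebra_simps)
  qed
  ultimately show ?thesis by blast
qed

definition ball_of :: "'v \<Rightarrow> nat \<Rightarrow> 'v set" where
  "ball_of s n = {t. \<exists>k\<le>n. (adj ^^ k) s t}"

text \<open>The factor gained in one step of the recursion: \<open>d\<close> neighbours, times the
  oscillation \<open>d / (N - d)\<close> of the single-site law.\<close>

definition \<theta> :: real where "\<theta> = real d ^ 2 / (real N - real d)"

lemma \<theta>_pos: "\<theta> > 0"
  using d_pos many_states by (simp add: \<theta>_def)

lemma self_in_ball: "s \<in> ball_of s n"
  by (auto simp: ball_of_def intro: exI[of _ 0])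

text \<open>Radius 0 is the trivial bound. For the step, resampling \<open>s\<close> turns
  \<open>h\<close> into a function \<open>g\<close> of the neighbours with oscillation at most
  \<open>d / (N - d)\<close>. The ball of radius \<open>n\<close> around a neighbour lies in the
  ball of radius \<open>Suc n\<close> around \<open>s\<close>, so the induction hypothesis bounds
  the change at each neighbour by \<open>\<theta> ^ n\<close>, and \<open>influence_joint\<close>
  adds these up.\<close>

lemma influence_site:
  assumes "finite \<Lambda>" "\<And>c. 0 \<le> h c \<and> h c \<le> (1::real)"
    and "\<And>t. t \<in> ball_of s n \<Longrightarrow> t \<notin> \<Lambda> \<Longrightarrow> \<omega> t = \<omega>' t"
  shows "G \<Lambda> (\<lambda>\<eta>. h (\<eta> s)) \<omega> - G \<Lambda> (\<lambda>\<eta>. h (\<eta> s)) \<omega>' \<le> \<theta> ^ n"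
  using assms
proof (induction n arbitrary: s \<Lambda> h \<omega> \<omega>')
  case 0
  then have "G \<Lambda> (\<lambda>\<eta>. h (\<eta> s)) \<omega> \<le> 1" "0 \<le> G \<Lambda> (\<lambda>\<eta>. h (\<eta> s)) \<omega>'"
    using G_bounds[of \<Lambda> 0 "\<lambda>\<eta>. h (\<eta> s)" 1] by auto
  then show ?case by simp
next
  case (Suc n)
  show ?case
  proof (cases "s \<in> \<Lambda>")
    case False
    then have "G \<Lambda> (\<lambda>\<eta>. h (\<eta> s)) \<omega> = h (\<omega> s)" for \<omega>
      using G_pull_out[of \<Lambda> "\<lambda>\<eta>. h (\<eta> s)" \<omega> "\<lambda>_. 1"] Suc.prems(1) by (simp add: G_const)
    moreover have "\<omega> s = \<omega>' s" using Suc.prems(3) False self_in_ball by blast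
    ultimately show ?thesis using zero_le_power[OF less_imp_le[OF \<theta>_pos], of "Suc n"] by simp
  next
    case True
    define g where "g = G {s} (\<lambda>\<eta>. h (\<eta> s))"
    \<comment> \<open>The sites of disagreement. They avoid the ball of radius \<open>n\<close>
      around every neighbour of \<open>s\<close>, hence in particular the neighbours
      themselves.\<close>
    define D where "D = {t. t \<notin> \<Lambda> \<and> \<omega> t \<noteq> \<omega>' t}"
    let ?J = "{t. adj s t}" and ?\<kappa> = "d / (real N - real d)"
    have g_eq: "g \<zeta> = (\<Sum>c\<in>{1..N}. site_prob s \<zeta> c * h c)" for \<zeta>
      by (simp add: g_def G_single_site_prob)
    have "depends_on g ?J"
      unfolding depends_on_def
    proof (intro allI impI)
      fix \<zeta> \<zeta>' :: "'v \<Rightarrow> nat" assume "\<forall>t\<in>?J. \<zeta> t = \<zeta>' t"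
      then have "occ s \<zeta> c = occ s \<zeta>' c" for c by (intro occ_cong) simp
      then show "g \<zeta> = g \<zeta>'" by (simp add: g_eq site_prob_def)
    qed
    \<comment> \<open>\<open>site_prob_diff\<close> bounds the difference of any two values of
      \<open>g\<close>; the infimum turns this into the interval that \<open>influence_joint\<close>
      asks for.\<close>
    define l where "l = Inf (range g)"
    have "g \<zeta> \<ge> 0" for \<zeta>
      unfolding g_eq using Suc.prems(2)
      by (intro sum_nonneg mult_nonneg_nonneg less_imp_le[OF site_prob_pos]) simp
    then have bdd: "bdd_below (range g)" by (auto simp: bdd_below_def)
    have l: "l \<le> g \<zeta> \<and> g \<zeta> \<le> l + ?\<kappa>" for \<zeta>
    proof
      show "l \<le> g \<zeta>" unfolding l_def using bdd by (simp add: cInf_lower)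
      have "g \<zeta> - ?\<kappa> \<le> l" unfolding l_def
      proof (rule cInf_greatest)
        fix x assume "x \<in> range g"
        then obtain \<zeta>' where "x = g \<zeta>'" by auto
        with site_prob_diff[of h s \<zeta> \<zeta>', OF Suc.prems(2)] show "g \<zeta> - ?\<kappa> \<le> x"
          unfolding g_eq by simp
      qed simp
      then show "g \<zeta> \<le> l + ?\<kappa>" by simp
    qed
    have nbr: "t \<notin> D" if "adj s u" "t \<in> ball_of u n" for u t
    proof -
      from that obtain k where "k \<le> n" "(adj ^^ k) u t" by (auto simp: ball_of_def)
      with that(1) have "(adj ^^ Suc k) s t" "Suc k \<le> Suc n" by (blast intro: relpowp_Suc_I2)+
      then have "t \<in> ball_of s (Suc n)" unfolding ball_of_def by blast
      then show ?thesis using Suc.prems(3) by (auto simp: D_def)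
    qed
    have "G \<Lambda> (\<lambda>\<eta>. h (\<eta> s)) \<omega> - G \<Lambda> (\<lambda>\<eta>. h (\<eta> s)) \<omega>' = G \<Lambda> g \<omega> - G \<Lambda> g \<omega>'"
      unfolding g_def using Suc.prems(1) True by (simp add: G_comp)
    also have "\<dots> \<le> card (?J \<inter> \<Lambda>) * (?\<kappa> * \<theta> ^ n)"
    proof (rule influence_joint[where l = l and D = D])
      show "?J \<inter> D \<subseteq> \<Lambda>" using nbr self_in_ball by blast
      fix u \<Lambda>' and h :: "nat \<Rightarrow> real" and \<zeta> \<zeta>' :: "'v \<Rightarrow> nat"
      assume *: "u \<in> ?J" "\<Lambda>' \<subseteq> \<Lambda>" "\<And>c. 0 \<le> h c \<and> h c \<le> (1::real)" "\<And>t. t \<notin> \<Lambda>' \<union> D \<Longrightarrow> \<zeta> t = \<zeta>' t"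
      show "G \<Lambda>' (\<lambda>\<eta>. h (\<eta> u)) \<zeta> - G \<Lambda>' (\<lambda>\<eta>. h (\<eta> u)) \<zeta>' \<le> \<theta> ^ n"
      proof (rule Suc.IH)
        show "finite \<Lambda>'" using *(2) Suc.prems(1) by (rule finite_subset)
        show "0 \<le> h c \<and> h c \<le> 1" for c by (rule *(3))
        fix t assume "t \<in> ball_of u n" "t \<notin> \<Lambda>'"
        with nbr[of u t] *(1) have "t \<notin> \<Lambda>' \<union> D" by blast
        then show "\<zeta> t = \<zeta>' t" by (rule *(4))
      qed
    qed (use Suc.prems(1) l \<open>depends_on g ?J\<close> finite_nbrs many_states \<theta>_pos in
        \<open>auto simp: D_def\<close>)
    also have "\<dots> \<le> d * (?\<kappa> * \<theta> ^ n)"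
    proof (rule mult_right_mono)
      show "real (card (?J \<inter> \<Lambda>)) \<le> real d"
        using card_mono[OF finite_nbrs[of s], of "?J \<inter> \<Lambda>"] card_nbrs[of s] by auto
    qed (use many_states \<theta>_pos in simp)
    also have "\<dots> = \<theta> ^ Suc n" by (simp add: \<theta>_def power2_eq_square)
    finally show ?thesis .
  qed
qed

text \<open>Each site of \<open>J\<close> contributes at most \<open>\<theta> ^ n\<close> when its
  own ball sees no disagreement outside \<open>\<Lambda>\<close>; the absolute value comes from
  exchanging the two boundary conditions.\<close>

lemma influence_local:
  assumes fin: "finite \<Lambda>" "finite J" and g: "depends_on g J" "\<And>\<omega>. 0 \<le> g \<omega> \<and> g \<omega> \<le> 1"
    and agree: "\<And>s t. s \<in> J \<Longrightarrow> t \<in> ball_of s n \<Longrightarrow> t \<notin> \<Lambda> \<Longrightarrow> \<omega> t = \<omega>' t"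
  shows "\<bar>G \<Lambda> g \<omega> - G \<Lambda> g \<omega>'\<bar> \<le> card J * \<theta> ^ n"
proof -
  have *: "G \<Lambda> g \<omega> - G \<Lambda> g \<omega>' \<le> card J * \<theta> ^ n"
    if agree: "\<And>s t. s \<in> J \<Longrightarrow> t \<in> ball_of s n \<Longrightarrow> t \<notin> \<Lambda> \<Longrightarrow> \<omega> t = \<omega>' t" for \<omega> \<omega>'
  proof -
    let ?D = "{t. t \<notin> \<Lambda> \<and> \<omega> t \<noteq> \<omega>' t}"
    have "G \<Lambda> g \<omega> - G \<Lambda> g \<omega>' \<le> card (J \<inter> \<Lambda>) * (1 * \<theta> ^ n)"
    proof (rule influence_joint[where l = 0 and D = ?D])
      show "J \<inter> ?D \<subseteq> \<Lambda>" using agree self_in_ball by blast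
      fix u \<Lambda>' and h :: "nat \<Rightarrow> real" and \<zeta> \<zeta>' :: "'v \<Rightarrow> nat"
      assume *: "u \<in> J" "\<Lambda>' \<subseteq> \<Lambda>" "\<And>c. 0 \<le> h c \<and> h c \<le> (1::real)" "\<And>t. t \<notin> \<Lambda>' \<union> ?D \<Longrightarrow> \<zeta> t = \<zeta>' t"
      show "G \<Lambda>' (\<lambda>\<eta>. h (\<eta> u)) \<zeta> - G \<Lambda>' (\<lambda>\<eta>. h (\<eta> u)) \<zeta>' \<le> \<theta> ^ n"
      proof (rule influence_site)
        show "finite \<Lambda>'" using *(2) fin(1) by (rule finite_subset)
        show "0 \<le> h c \<and> h c \<le> 1" for c by (rule *(3))
        fix t assume "t \<in> ball_of u n" "t \<notin> \<Lambda>'"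
        with agree[of u t] *(1) have "t \<notin> \<Lambda>' \<union> ?D" by blast
        then show "\<zeta> t = \<zeta>' t" by (rule *(4))
      qed
    qed (use fin g \<theta>_pos in auto)
    also have "\<dots> \<le> card J * (1 * \<theta> ^ n)"
      using fin(2) \<theta>_pos by (intro mult_right_mono) (auto intro: card_mono)
    finally show ?thesis by simp
  qed
  have "G \<Lambda> g \<omega> - G \<Lambda> g \<omega>' \<le> card J * \<theta> ^ n" using agree by (rule *)
  moreover have "G \<Lambda> g \<omega>' - G \<Lambda> g \<omega> \<le> card J * \<theta> ^ n" using agree by (intro *) force
  ultimately show ?thesis by (simp add: abs_le_iff)
qed

end

section \<open>Mixing in finite volume\<close>

context potts begin

lemma in_configs: "\<omega> \<in> configs N \<longleftrightarrow> (\<forall>t. \<omega> t \<in> {1..N})"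
  by (auto simp: configs_def)

lemma override_in_configs: "\<omega> \<in> configs N \<Longrightarrow> w \<in> cfg \<Lambda> \<Longrightarrow> override_on \<omega> w \<Lambda> \<in> configs N"
  by (auto simp: in_configs override_on_def PiE_def Pi_def)

text \<open>By the tower property \<open>s\<close> may be resampled last, and its single-site law is
  at least \<open>p_min\<close> whatever its neighbours show.\<close>

lemma G_site_ge:
  assumes "finite \<Lambda>" "s \<in> \<Lambda>" "a \<in> {1..N}"
  shows "p_min \<le> G \<Lambda> (\<lambda>\<eta>. of_bool (\<eta> s = a)) \<omega>"
proof -
  have "G {s} (\<lambda>\<eta>. of_bool (\<eta> s = a)) \<zeta> = site_prob s \<zeta> a" for \<zeta>
  proof -
    have "G {s} (\<lambda>\<eta>. of_bool (\<eta> s = a)) \<zeta> = (\<Sum>c\<in>{1..N}. if c = a then site_prob s \<zeta> c else 0)"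
      unfolding G_single_site_prob by (rule sum.cong) auto
    also have "\<dots> = site_prob s \<zeta> a" using assms(3) by simp
    finally show ?thesis .
  qed
  then have "p_min \<le> G \<Lambda> (G {s} (\<lambda>\<eta>. of_bool (\<eta> s = a))) \<omega>"
    by (intro G_ge[OF assms(1)]) (simp add: site_prob_ge)
  then show ?thesis using assms by (simp add: G_comp)
qed

text \<open>
  Bayes' rule: resampling \<open>s\<close> changes the weight of \<open>f\<close> only through the influence of
  \<open>U\<close> on the state at \<open>s\<close>.
\<close>

lemma resample_ratio:
  assumes fin: "finite \<Lambda>" and s: "s \<notin> \<Lambda>" "s \<notin> U"
    and f: "depends_on f U" "\<And>\<omega>. f \<omega> \<ge> (0::real)"
    and \<eta>: "\<eta> s \<in> {1..N}" and \<epsilon>: "\<epsilon> \<ge> 0"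
    and far: "U = {} \<or> (\<exists>n. U \<inter> ball_of s n = {} \<and> \<theta> ^ n \<le> \<epsilon> * p_min)"
  shows "G \<Lambda> f \<eta> \<le> (1 + \<epsilon>) * G (insert s \<Lambda>) f \<eta>"
    and "G (insert s \<Lambda>) f \<eta> \<le> (1 + \<epsilon>) * G \<Lambda> f \<eta>"
proof -
  let ?M = "insert s \<Lambda>" and ?R = "insert s \<Lambda> - U"
  define h :: "nat \<Rightarrow> real" where "h c = of_bool (c = \<eta> s)" for c
  have h: "0 \<le> h c \<and> h c \<le> 1" for c by (simp add: h_def)
  \<comment> \<open>The conditional probability that \<open>s\<close> shows \<open>\<eta> s\<close>
    when the sites of \<open>U\<close> are known: everything in \<open>?M\<close> except
    \<open>U\<close> is resampled. Its mean \<open>p\<close> is the unconditional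
    probability.\<close>
  define \<pi> where "\<pi> = G ?R (\<lambda>\<zeta>. h (\<zeta> s))"
  define p where "p = G ?M \<pi> \<eta>"
  have finM: "finite ?M" and finR: "finite ?R" using fin by auto
  have p_eq: "p = G ?M (\<lambda>\<zeta>. h (\<zeta> s)) \<eta>"
    unfolding p_def \<pi>_def by (rule G_comp[OF finM]) auto
  have p_pos: "p > 0"
    using G_site_ge[OF finM, of s "\<eta> s" \<eta>] \<eta> p_min_pos by (simp add: p_eq h_def)
  have \<pi>_ge: "p_min \<le> \<pi> \<zeta>" for \<zeta>
    using G_site_ge[OF finR, of s "\<eta> s" \<zeta>] \<eta> s by (simp add: \<pi>_def h_def)
  let ?ov = "\<lambda>w. override_on \<eta> w ?M"
  \<comment> \<open>Two configurations on \<open>?M\<close> can influence \<open>\<pi>\<close> only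
    through \<open>U\<close>, which is far from \<open>s\<close>. As \<open>\<pi>\<close> is at
    least \<open>p_min\<close>, the additive error \<open>\<theta> ^ n\<close> is at most
    \<open>\<epsilon>\<close> times \<open>\<pi>\<close>.\<close>
  have osc: "\<pi> (?ov w) \<le> (1 + \<epsilon>) * \<pi> (?ov w')" for w w'
  \<comment> \<open>For empty \<open>U\<close> the allowance \<open>\<epsilon>\<close> may be 0,
    below every power of \<open>\<theta>\<close>; but then \<open>\<pi>\<close> resamples all of
    \<open>?M\<close> and does not vary.\<close>
  proof (cases "U = {}")
    case True
    then have "\<pi> (?ov w) = \<pi> (?ov w')" unfolding \<pi>_def by (intro G_agree) simp
    then show ?thesis using \<epsilon> \<pi>_ge[of "?ov w'"] p_min_pos by (simp add: mult_le_cancel_right1)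
  next
    case False
    with far obtain n where n: "U \<inter> ball_of s n = {}" "\<theta> ^ n \<le> \<epsilon> * p_min" by blast
    have "\<pi> (?ov w) - \<pi> (?ov w') \<le> \<theta> ^ n"
      unfolding \<pi>_def using finR h
    proof (rule influence_site)
      fix t assume "t \<in> ball_of s n" "t \<notin> ?R"
      then show "?ov w t = ?ov w' t" using n(1) by (auto simp: override_on_def)
    qed
    moreover have "\<epsilon> * p_min \<le> \<epsilon> * \<pi> (?ov w')" using \<pi>_ge \<epsilon> by (rule mult_left_mono)
    ultimately show ?thesis using n(2) by (simp add: distrib_right)
  qed
  have \<pi>_le: "\<pi> (?ov w) \<le> (1 + \<epsilon>) * p" for w
    unfolding p_def G_cmult[symmetric] by (rule G_ge[OF finM]) (rule osc)
  have \<pi>_ge_p: "p \<le> (1 + \<epsilon>) * \<pi> (?ov w)" for w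
    unfolding p_def by (rule G_le[OF finM]) (rule osc)
  \<comment> \<open>Bayes' rule in two halves, for the joint expectation of \<open>f\<close> and the
    event that \<open>s\<close> shows \<open>\<eta> s\<close>. Conditioning on the state at
    \<open>s\<close> gives \<open>G \<Lambda> f \<eta> * p\<close>; conditioning on all sites
    outside \<open>?R\<close> replaces the event by \<open>\<pi>\<close>, which is \<open>p\<close>
    up to a factor \<open>1 + \<epsilon>\<close>.\<close>
  have X1: "G ?M (\<lambda>\<zeta>. f \<zeta> * h (\<zeta> s)) \<eta> = G \<Lambda> f \<eta> * p"
  proof -
    have "G ?M (\<lambda>\<zeta>. f \<zeta> * h (\<zeta> s)) \<eta> = G ?M (G \<Lambda> (\<lambda>\<zeta>. h (\<zeta> s) * f \<zeta>)) \<eta>"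
      by (subst G_comp[OF finM]) (auto simp: mult.commute)
    also have "\<dots> = G ?M (\<lambda>\<zeta>. G \<Lambda> f \<eta> * h (\<zeta> s)) \<eta>"
    proof (rule G_cong)
      fix w
      have "G \<Lambda> (\<lambda>\<zeta>. h (\<zeta> s) * f \<zeta>) (?ov w) = h (?ov w s) * G \<Lambda> f (?ov w)"
        using s by (intro G_pull_out[where g = "\<lambda>\<zeta>. h (\<zeta> s)"]) simp
      also have "\<dots> = h (?ov w s) * G \<Lambda> f \<eta>"
      proof (cases "w s = \<eta> s")
        case True
        then have "G \<Lambda> f (?ov w) = G \<Lambda> f \<eta>" by (intro G_agree) (auto simp: override_on_def)
        then show ?thesis by simp
      qed (simp add: h_def)
      finally show "G \<Lambda> (\<lambda>\<zeta>. h (\<zeta> s) * f \<zeta>) (?ov w) = G \<Lambda> f \<eta> * h (?ov w s)"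
        by (simp add: mult.commute)
    qed
    finally show ?thesis by (simp only: G_cmult p_eq)
  qed
  have X2: "G ?M (\<lambda>\<zeta>. f \<zeta> * h (\<zeta> s)) \<eta> = G ?M (\<lambda>\<zeta>. f \<zeta> * \<pi> \<zeta>) \<eta>"
  proof -
    have "G ?M (\<lambda>\<zeta>. f \<zeta> * h (\<zeta> s)) \<eta> = G ?M (G ?R (\<lambda>\<zeta>. f \<zeta> * h (\<zeta> s))) \<eta>"
      by (rule G_comp[OF finM, symmetric]) auto
    also have "\<dots> = G ?M (\<lambda>\<zeta>. f \<zeta> * \<pi> \<zeta>) \<eta>"
      unfolding \<pi>_def by (intro G_cong G_pull_out depends_onD[OF f(1)]) simp
    finally show ?thesis .
  qed
  have "G ?M (\<lambda>\<zeta>. f \<zeta> * \<pi> \<zeta>) \<eta> \<le> G ?M (\<lambda>\<zeta>. ((1 + \<epsilon>) * p) * f \<zeta>) \<eta>"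
    by (rule G_mono[OF finM], subst mult.commute, rule mult_right_mono[OF \<pi>_le f(2)])
  then have "G \<Lambda> f \<eta> * p \<le> ((1 + \<epsilon>) * p) * G ?M f \<eta>"
    by (simp only: X1[symmetric] X2 G_cmult)
  then show "G \<Lambda> f \<eta> \<le> (1 + \<epsilon>) * G ?M f \<eta>" using p_pos by (simp add: mult_ac)
  have "G ?M (\<lambda>\<zeta>. p * f \<zeta>) \<eta> \<le> G ?M (\<lambda>\<zeta>. (1 + \<epsilon>) * (f \<zeta> * \<pi> \<zeta>)) \<eta>"
  proof (rule G_mono[OF finM])
    fix w
    have "p * f (?ov w) \<le> ((1 + \<epsilon>) * \<pi> (?ov w)) * f (?ov w)"
      by (rule mult_right_mono[OF \<pi>_ge_p f(2)])
    then show "p * f (?ov w) \<le> (1 + \<epsilon>) * (f (?ov w) * \<pi> (?ov w))" by (simp add: mult_ac)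
  qed
  then have "p * G ?M f \<eta> \<le> (1 + \<epsilon>) * (G \<Lambda> f \<eta> * p)"
    by (simp only: X1[symmetric] X2 G_cmult)
  then have "p * G ?M f \<eta> \<le> p * ((1 + \<epsilon>) * G \<Lambda> f \<eta>)" by (simp only: mult_ac)
  then show "G ?M f \<eta> \<le> (1 + \<epsilon>) * G \<Lambda> f \<eta>" using p_pos by simp
qed

lemma resample_set_ratio:
  assumes "finite V" "finite \<Lambda>" "V \<subseteq> \<Lambda>" "U \<inter> V = {}"
    and f: "depends_on f U" "\<And>\<omega>. f \<omega> \<ge> (0::real)" and \<eta>: "\<eta> \<in> configs N"
    and "\<And>s. s \<in> V \<Longrightarrow> \<epsilon> s \<ge> 0"
    and "\<And>s. s \<in> V \<Longrightarrow> U = {} \<or> (\<exists>n. U \<inter> ball_of s n = {} \<and> \<theta> ^ n \<le> \<epsilon> s * p_min)"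
  shows "G (\<Lambda> - V) f \<eta> \<le> (\<Prod>s\<in>V. 1 + \<epsilon> s) * G \<Lambda> f \<eta> \<and>
    G \<Lambda> f \<eta> \<le> (\<Prod>s\<in>V. 1 + \<epsilon> s) * G (\<Lambda> - V) f \<eta>"
  using assms(1,3,4,8,9)
proof (induction V rule: finite_induct)
  case (insert s V)
  let ?P = "\<Prod>s\<in>V. 1 + \<epsilon> s"
  have P: "?P \<ge> 0" using insert.prems(3) by (intro prod_nonneg) auto
  have IH: "G (\<Lambda> - V) f \<eta> \<le> ?P * G \<Lambda> f \<eta>" "G \<Lambda> f \<eta> \<le> ?P * G (\<Lambda> - V) f \<eta>"
    using insert.IH insert.prems by auto
  have eq: "insert s (\<Lambda> - insert s V) = \<Lambda> - V" using insert by auto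
  have 1: "G (\<Lambda> - insert s V) f \<eta> \<le> (1 + \<epsilon> s) * G (\<Lambda> - V) f \<eta>"
    "G (\<Lambda> - V) f \<eta> \<le> (1 + \<epsilon> s) * G (\<Lambda> - insert s V) f \<eta>"
    using resample_ratio[of "\<Lambda> - insert s V" s U f \<eta> "\<epsilon> s"] insert.prems assms(2) f \<eta>
    unfolding eq by (auto simp: in_configs)
  have "(1 + \<epsilon> s) * G (\<Lambda> - V) f \<eta> \<le> (1 + \<epsilon> s) * (?P * G \<Lambda> f \<eta>)"
    "?P * G (\<Lambda> - V) f \<eta> \<le> ?P * ((1 + \<epsilon> s) * G (\<Lambda> - insert s V) f \<eta>)"
    using IH 1 P insert.prems(3)[of s] by (auto intro!: mult_left_mono)
  then show ?case using 1 IH insert.hyps by (simp add: mult_ac)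
qed simp

text \<open>Conditioning on everything outside \<open>\<Lambda> - V\<close> turns the product into
  \<open>g\<close> times \<open>G (\<Lambda> - V) f\<close>, and the latter agrees with the mean of
  \<open>f\<close> up to the product of the factors \<open>1 + \<epsilon> s\<close>, uniformly in
  the configuration on \<open>V\<close>.\<close>

lemma mixing_finite:
  assumes fin: "finite V" "finite \<Lambda>" and V: "V \<subseteq> \<Lambda>" "U \<inter> V = {}"
    and f: "depends_on f U" "\<And>\<omega>. f \<omega> \<ge> (0::real)"
    and g: "depends_on g V" "\<And>\<omega>. g \<omega> \<ge> (0::real)" and \<eta>: "\<eta> \<in> configs N"
    and \<epsilon>: "\<And>s. s \<in> V \<Longrightarrow> \<epsilon> s \<ge> 0" "(\<Sum>s\<in>V. \<epsilon> s) \<le> 1"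
    and far: "\<And>s. s \<in> V \<Longrightarrow> U = {} \<or> (\<exists>n. U \<inter> ball_of s n = {} \<and> \<theta> ^ n \<le> \<epsilon> s * p_min)"
  shows "\<bar>G \<Lambda> (\<lambda>\<omega>. g \<omega> * f \<omega>) \<eta> - G \<Lambda> g \<eta> * G \<Lambda> f \<eta>\<bar>
    \<le> 2 * (\<Sum>s\<in>V. \<epsilon> s) * (G \<Lambda> g \<eta> * G \<Lambda> f \<eta>)"
proof -
  let ?P = "\<Prod>s\<in>V. 1 + \<epsilon> s" and ?S = "\<Sum>s\<in>V. \<epsilon> s"
  have S: "?S \<ge> 0" using \<epsilon> by (simp add: sum_nonneg)
  have P1: "?P \<ge> 1" using \<epsilon>(1) by (intro prod_ge_1) auto
  \<comment> \<open>With \<open>?S\<close> at most 1 the exponential bound gives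
    \<open>?P \<le> 1 + ?S + ?S\<^sup>2 \<le> 1 + 2 * ?S\<close>, the origin of the factor 2 in the
    conclusion.\<close>
  have "?P \<le> (\<Prod>s\<in>V. exp (\<epsilon> s))"
    using \<epsilon>(1) by (intro prod_mono) (auto intro: exp_ge_add_one_self add_nonneg_nonneg)
  also have "\<dots> = exp ?S" using fin(1) by (simp add: exp_sum)
  also have "\<dots> \<le> 1 + ?S + ?S\<^sup>2" using S \<epsilon>(2) by (intro exp_bound)
  also have "?S\<^sup>2 \<le> ?S" using S \<epsilon>(2) by (simp add: power2_eq_square mult_left_le)
  finally have P2: "?P - 1 \<le> 2 * ?S" by simp
  let ?f = "G \<Lambda> f \<eta>" and ?g = "G \<Lambda> g \<eta>"
  have nn: "?f \<ge> 0" "?g \<ge> 0" using f(2) g(2) fin(2) by (auto intro: G_ge)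
  have eq: "G \<Lambda> (\<lambda>\<omega>. g \<omega> * f \<omega>) \<eta> = G \<Lambda> (\<lambda>\<omega>. g \<omega> * G (\<Lambda> - V) f \<omega>) \<eta>"
  proof -
    have "G \<Lambda> (\<lambda>\<omega>. g \<omega> * f \<omega>) \<eta> = G \<Lambda> (G (\<Lambda> - V) (\<lambda>\<omega>. g \<omega> * f \<omega>)) \<eta>"
      by (rule G_comp[OF fin(2), symmetric]) auto
    also have "\<dots> = G \<Lambda> (\<lambda>\<omega>. g \<omega> * G (\<Lambda> - V) f \<omega>) \<eta>"
      by (intro G_cong G_pull_out depends_onD[OF g(1)]) simp
    finally show ?thesis .
  qed
  have ratio: "G (\<Lambda> - V) f (override_on \<eta> w \<Lambda>) \<le> ?P * ?f"
    "?f \<le> ?P * G (\<Lambda> - V) f (override_on \<eta> w \<Lambda>)" if "w \<in> cfg \<Lambda>" for w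
    using resample_set_ratio[OF fin V f override_in_configs[OF \<eta> that] \<epsilon>(1) far]
    by (simp_all add: G_override)
  have "G \<Lambda> (\<lambda>\<omega>. g \<omega> * G (\<Lambda> - V) f \<omega>) \<eta> \<le> G \<Lambda> (\<lambda>\<omega>. (?P * ?f) * g \<omega>) \<eta>"
    by (rule G_mono[OF fin(2)], subst mult.commute[of _ "g _"]) (intro mult_left_mono ratio g(2))
  then have up: "G \<Lambda> (\<lambda>\<omega>. g \<omega> * f \<omega>) \<eta> \<le> ?P * (?g * ?f)"
    unfolding eq[symmetric] G_cmult by (simp add: mult_ac)
  have "G \<Lambda> (\<lambda>\<omega>. ?f * g \<omega>) \<eta> \<le> G \<Lambda> (\<lambda>\<omega>. ?P * (g \<omega> * G (\<Lambda> - V) f \<omega>)) \<eta>"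
  proof (rule G_mono[OF fin(2)])
    fix w assume "w \<in> cfg \<Lambda>"
    from mult_right_mono[OF ratio(2)[OF this] g(2)[of "override_on \<eta> w \<Lambda>"]]
    show "?f * g (override_on \<eta> w \<Lambda>) \<le>
        ?P * (g (override_on \<eta> w \<Lambda>) * G (\<Lambda> - V) f (override_on \<eta> w \<Lambda>))"
      by (simp add: mult_ac)
  qed
  then have lo: "?g * ?f \<le> ?P * G \<Lambda> (\<lambda>\<omega>. g \<omega> * f \<omega>) \<eta>"
    unfolding eq[symmetric] G_cmult by (simp add: mult_ac)
  \<comment> \<open>The lower bound with factor \<open>1 / ?P\<close> is weakened to
    \<open>2 - ?P\<close>, so that both deviations are at most \<open>?P - 1\<close>.\<close>
  have "(2 - ?P) * (?g * ?f) \<le> G \<Lambda> (\<lambda>\<omega>. g \<omega> * f \<omega>) \<eta>"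
  proof -
    have "?P * ((2 - ?P) * (?g * ?f)) = (1 - (?P - 1)\<^sup>2) * (?g * ?f)"
      by (simp add: power2_eq_square algebra_simps)
    also have "\<dots> \<le> 1 * (?g * ?f)"
      using nn by (intro mult_right_mono) auto
    also have "\<dots> \<le> ?P * G \<Lambda> (\<lambda>\<omega>. g \<omega> * f \<omega>) \<eta>" using lo by simp
    finally show ?thesis using P1 by simp
  qed
  with up have "\<bar>G \<Lambda> (\<lambda>\<omega>. g \<omega> * f \<omega>) \<eta> - ?g * ?f\<bar> \<le> (?P - 1) * (?g * ?f)"
    by (simp add: algebra_simps abs_le_iff)
  also have "\<dots> \<le> (2 * ?S) * (?g * ?f)"
    using P2 nn by (intro mult_right_mono) auto
  finally show ?thesis .
qed

end

section \<open>Cylinder sets\<close>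

definition cylinders :: "nat \<Rightarrow> 'v set \<Rightarrow> ('v \<Rightarrow> nat) set set" where
  "cylinders N U =
    {{\<omega> \<in> configs N. P \<omega>} | P J. finite J \<and> J \<subseteq> U \<and> depends_on P J}"

lemma cylindersI: "finite J \<Longrightarrow> J \<subseteq> U \<Longrightarrow> depends_on P J \<Longrightarrow> {\<omega> \<in> configs N. P \<omega>} \<in> cylinders N U"
  by (auto simp: cylinders_def)

lemma cylindersE:
  assumes "A \<in> cylinders N U"
  obtains P J where "A = {\<omega> \<in> configs N. P \<omega>}" "finite J" "J \<subseteq> U" "depends_on P J"
  using assms by (auto simp: cylinders_def)

lemma cylinders_mono: "U \<subseteq> V \<Longrightarrow> cylinders N U \<subseteq> cylinders N V"
  by (auto elim!: cylindersE intro: cylindersI)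

lemma depends_on_mono: "depends_on f J \<Longrightarrow> J \<subseteq> K \<Longrightarrow> depends_on f K"
  by (auto simp: depends_on_def)

lemma depends_on_comp2:
  "depends_on f J \<Longrightarrow> depends_on g K \<Longrightarrow> depends_on (\<lambda>\<omega>. h (f \<omega>) (g \<omega>)) (J \<union> K)"
  unfolding depends_on_def by (intro allI impI arg_cong2[of _ _ _ _ h]) auto

lemma depends_on_comp: "depends_on f J \<Longrightarrow> depends_on (\<lambda>\<omega>. h (f \<omega>)) J"
  unfolding depends_on_def by (intro allI impI arg_cong[of _ _ h]) auto

lemma algebra_cylinders: "algebra (configs N) (cylinders N U)"
proof (rule algebra_iff_Un[THEN iffD2], intro conjI ballI)
  show "cylinders N U \<subseteq> Pow (configs N)" by (auto simp: cylinders_def)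
  show "{} \<in> cylinders N U"
    using cylindersI[of "{}" U "\<lambda>_. False" N] by (simp add: depends_on_def)
  fix A assume "A \<in> cylinders N U"
  then obtain P J where A: "A = {\<omega> \<in> configs N. P \<omega>}" "finite J" "J \<subseteq> U" "depends_on P J"
    by (rule cylindersE)
  from A(4) have "depends_on (\<lambda>\<omega>. \<not> P \<omega>) J" by (rule depends_on_comp)
  with A have "{\<omega> \<in> configs N. \<not> P \<omega>} \<in> cylinders N U" by (intro cylindersI)
  also have "{\<omega> \<in> configs N. \<not> P \<omega>} = configs N - A" using A(1) by auto
  finally show "configs N - A \<in> cylinders N U" .
  fix B assume "B \<in> cylinders N U"
  then obtain Q K where B: "B = {\<omega> \<in> configs N. Q \<omega>}" "finite K" "K \<subseteq> U" "depends_on Q K"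
    by (rule cylindersE)
  have "depends_on (\<lambda>\<omega>. P \<omega> \<or> Q \<omega>) (J \<union> K)" using A(4) B(4) by (rule depends_on_comp2)
  with A B have "{\<omega> \<in> configs N. P \<omega> \<or> Q \<omega>} \<in> cylinders N U" by (intro cylindersI) auto
  also have "{\<omega> \<in> configs N. P \<omega> \<or> Q \<omega>} = A \<union> B" using A(1) B(1) by auto
  finally show "A \<union> B \<in> cylinders N U" .
qed

section \<open>Cylinders as generators of the coordinate sigma-algebras\<close>

lemma config_algebra_gen_subset:
  "{{\<omega> \<in> configs N. \<omega> s \<in> A} | s A. s \<in> \<Lambda> \<and> A \<subseteq> {1..N}} \<subseteq> Pow (configs N)"
  by auto

lemma space_config_algebra [simp]: "space (config_algebra N U) = configs N"
  unfolding config_algebra_def by (rule space_measure_of) (rule config_algebra_gen_subset)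

text \<open>There are finitely many states, so the event is a finite union of patterns on
  \<open>J\<close>, each a finite intersection of one-site events.\<close>

lemma cylinder_in_config_algebra:
  assumes P: "depends_on P J" and "finite J" "J \<subseteq> U"
  shows "{\<omega> \<in> configs N. P \<omega>} \<in> sets (config_algebra N U)"
proof -
  let ?C = "\<lambda>w. {\<omega> \<in> configs N. \<forall>t\<in>J. \<omega> t = w t}"
  have eq: "{\<omega> \<in> configs N. P \<omega>} = (\<Union>w\<in>{w \<in> \<Pi>\<^sub>E s\<in>J. {1..N}. P w}. ?C w)"
  proof (intro set_eqI iffI)
    fix \<omega> assume \<omega>: "\<omega> \<in> {\<omega> \<in> configs N. P \<omega>}"
    then have "restrict \<omega> J \<in> {w \<in> \<Pi>\<^sub>E s\<in>J. {1..N}. P w}"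
      using depends_onD[OF P, of \<omega> "restrict \<omega> J"] by (auto simp: configs_def)
    moreover have "\<omega> \<in> ?C (restrict \<omega> J)" using \<omega> by auto
    ultimately show "\<omega> \<in> (\<Union>w\<in>{w \<in> \<Pi>\<^sub>E s\<in>J. {1..N}. P w}. ?C w)" by blast
  next
    fix \<omega> assume "\<omega> \<in> (\<Union>w\<in>{w \<in> \<Pi>\<^sub>E s\<in>J. {1..N}. P w}. ?C w)"
    then obtain w where "P w" "\<omega> \<in> ?C w" by blast
    with depends_onD[OF P, of w \<omega>] show "\<omega> \<in> {\<omega> \<in> configs N. P \<omega>}" by auto
  qed
  have C: "?C w \<in> sets (config_algebra N U)" if "w \<in> (\<Pi>\<^sub>E s\<in>J. {1..N})" for w
  proof -
    have "{\<omega> \<in> space (config_algebra N U). \<forall>t\<in>J. \<omega> t = w t} \<in> sets (config_algebra N U)"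
    proof (rule sets.sets_Collect_finite_All[OF _ assms(2)])
      fix t assume "t \<in> J"
      with that assms(3) have "t \<in> U" "{w t} \<subseteq> {1..N}" by auto
      then have "{\<omega> \<in> configs N. \<omega> t \<in> {w t}} \<in> sets (config_algebra N U)"
        unfolding config_algebra_def sets_measure_of[OF config_algebra_gen_subset]
        by (intro sigma_sets.Basic) blast
      then show "{\<omega> \<in> space (config_algebra N U). \<omega> t = w t} \<in> sets (config_algebra N U)" by simp
    qed
    then show ?thesis by simp
  qed
  have "finite {w \<in> \<Pi>\<^sub>E s\<in>J. {1..N}. P w}" using assms(2) by (simp add: finite_PiE)
  then show ?thesis unfolding eq using C by (intro sets.finite_UN) auto
qed

text \<open>Exchanges the one-site generators for an algebra of sets, the form needed for extension
  of measures, uniqueness and approximation.\<close>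

lemma sets_config_algebra: "sets (config_algebra N U) = sigma_sets (configs N) (cylinders N U)"
proof
  have "{{\<omega> \<in> configs N. \<omega> s \<in> A} | s A. s \<in> U \<and> A \<subseteq> {1..N}} \<subseteq> cylinders N U"
  proof clarify
    fix s and A :: "nat set" assume "s \<in> U"
    then show "{\<omega> \<in> configs N. \<omega> s \<in> A} \<in> cylinders N U"
      by (intro cylindersI[of "{s}"]) (auto simp: depends_on_def)
  qed
  then show "sets (config_algebra N U) \<subseteq> sigma_sets (configs N) (cylinders N U)"
    unfolding config_algebra_def sets_measure_of[OF config_algebra_gen_subset]
    by (intro sigma_sets_mono')
  have "cylinders N U \<subseteq> sets (config_algebra N U)"
    by (auto elim!: cylindersE intro: cylinder_in_config_algebra)
  then show "sigma_sets (configs N) (cylinders N U) \<subseteq> sets (config_algebra N U)"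
    using sets.sigma_sets_subset[of "cylinders N U" "config_algebra N U"] by simp
qed

section \<open>The product topology and its Borel sets\<close>

lemma topspace_config [simp]: "topspace (config_topology N) = configs N"
  by (auto simp: config_topology_def configs_def)

lemma openin_config:
  "openin (config_topology N) S \<longleftrightarrow> S \<subseteq> configs N \<and>
    (\<forall>\<omega>\<in>S. \<exists>J. finite J \<and> {\<eta> \<in> configs N. \<forall>t\<in>J. \<eta> t = \<omega> t} \<subseteq> S)"
    (is "?L \<longleftrightarrow> ?R")
proof
  assume L: ?L
  show ?R
  proof (intro conjI ballI)
    show sub: "S \<subseteq> configs N" using openin_subset[OF L] by simp
    fix \<omega> assume "\<omega> \<in> S"
    with L obtain B where B: "finite {t. B t \<noteq> {1..N}}" "\<omega> \<in> Pi\<^sub>E UNIV B" "Pi\<^sub>E UNIV B \<subseteq> S"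
      by (auto simp: config_topology_def openin_product_topology_alt)
    show "\<exists>J. finite J \<and> {\<eta> \<in> configs N. \<forall>t\<in>J. \<eta> t = \<omega> t} \<subseteq> S"
    proof (intro exI conjI)
      show "{\<eta> \<in> configs N. \<forall>t\<in>{t. B t \<noteq> {1..N}}. \<eta> t = \<omega> t} \<subseteq> S"
      proof
        fix \<eta> assume \<eta>: "\<eta> \<in> {\<eta> \<in> configs N. \<forall>t\<in>{t. B t \<noteq> {1..N}}. \<eta> t = \<omega> t}"
        have "\<eta> t \<in> B t" for t
          using \<eta> B(2) by (cases "B t = {1..N}") (auto simp: configs_def PiE_iff)
        then have "\<eta> \<in> Pi\<^sub>E UNIV B" by auto
        with B(3) show "\<eta> \<in> S" by blast
      qed
    qed (rule B(1))
  qed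
next
  assume R: ?R
  show ?L
    unfolding config_topology_def openin_product_topology_alt
  proof
    fix \<omega> assume \<omega>: "\<omega> \<in> S"
    with R obtain J where J: "finite J" "{\<eta> \<in> configs N. \<forall>t\<in>J. \<eta> t = \<omega> t} \<subseteq> S" by blast
    have \<omega>c: "\<omega> \<in> configs N" using R \<omega> by blast
    let ?B = "\<lambda>t. if t \<in> J then {\<omega> t} else {1..N}"
    have B: "?B t \<subseteq> {1..N}" for t using \<omega>c by (auto simp: configs_def)
    show "\<exists>B. finite {i \<in> UNIV. B i \<noteq> topspace (discrete_topology {1..N})} \<and>
        (\<forall>i\<in>UNIV. openin (discrete_topology {1..N}) (B i)) \<and> \<omega> \<in> Pi\<^sub>E UNIV B \<and> Pi\<^sub>E UNIV B \<subseteq> S"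
    proof (intro exI[of _ ?B] conjI ballI)
      show "finite {i \<in> UNIV. ?B i \<noteq> topspace (discrete_topology {1..N})}"
        by (rule finite_subset[OF _ J(1)]) auto
      show "openin (discrete_topology {1..N}) (?B t)" for t
        unfolding openin_discrete_topology by (rule B)
      show "\<omega> \<in> Pi\<^sub>E UNIV ?B" using \<omega>c by (auto simp: configs_def)
      show "Pi\<^sub>E UNIV ?B \<subseteq> S"
      proof
        fix \<eta> assume \<eta>: "\<eta> \<in> Pi\<^sub>E UNIV ?B"
        then have "\<eta> t \<in> {1..N}" for t using B by blast
        moreover have "\<eta> t = \<omega> t" if "t \<in> J" for t
          using PiE_mem[OF \<eta>, of t] that by simp
        ultimately show "\<eta> \<in> S" using J(2) by (auto simp: configs_def)
      qed
    qed
  qed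
qed

lemma cylinder_open:
  assumes "A \<in> cylinders N U"
  shows "openin (config_topology N) A"
proof -
  from assms obtain P J where A: "A = {\<omega> \<in> configs N. P \<omega>}" "finite J" "J \<subseteq> U" "depends_on P J"
    by (rule cylindersE)
  show ?thesis unfolding openin_config
  proof (intro conjI ballI exI)
    fix \<omega> assume "\<omega> \<in> A"
    then have "P \<omega>" using A(1) by simp
    with depends_onD[OF A(4), of _ \<omega>] show "{\<eta> \<in> configs N. \<forall>t\<in>J. \<eta> t = \<omega> t} \<subseteq> A"
      unfolding A(1) by auto
  qed (use A in auto)
qed

text \<open>Countably many sites allow only countably many finite patterns, so every open set is a
  countable union of cylinders; conversely cylinders are open.\<close>

lemma sets_config_borel:
  assumes "countable (UNIV :: 'v set)"
  shows "sets (config_borel N :: ('v \<Rightarrow> nat) measure) = sigma_sets (configs N) (cylinders N UNIV)"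
proof -
  let ?O = "{S. openin (config_topology N) S} :: ('v \<Rightarrow> nat) set set"
  have sub: "?O \<subseteq> Pow (configs N)" using openin_subset by fastforce
  have "?O \<subseteq> sigma_sets (configs N) (cylinders N UNIV)"
  proof
    fix S :: "('v \<Rightarrow> nat) set" assume "S \<in> ?O"
    then have S: "S \<subseteq> configs N" "\<And>\<omega>. \<omega> \<in> S \<Longrightarrow> \<exists>J. finite J \<and> {\<eta> \<in> configs N. \<forall>t\<in>J. \<eta> t = \<omega> t} \<subseteq> S"
      by (auto simp: openin_config)
    let ?C = "\<lambda>(J, w). {\<eta> \<in> configs N. \<forall>t\<in>J. \<eta> t = (w t :: nat)}"
    let ?I = "SIGMA J : {J :: 'v set. finite J \<and> J \<subseteq> UNIV}. \<Pi>\<^sub>E s\<in>J. {1..N}"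
    have "S = \<Union> (?C ` {p \<in> ?I. ?C p \<subseteq> S})" (is "_ = ?U")
    proof
      show "S \<subseteq> ?U"
      proof
        fix \<omega> assume \<omega>: "\<omega> \<in> S"
        with S obtain J where J: "finite J" "{\<eta> \<in> configs N. \<forall>t\<in>J. \<eta> t = \<omega> t} \<subseteq> S" by blast
        have "\<omega> \<in> configs N" using \<omega> S by blast
        then have 1: "(J, restrict \<omega> J) \<in> ?I" "\<omega> \<in> ?C (J, restrict \<omega> J)" using J by (auto simp: configs_def)
        have 2: "?C (J, restrict \<omega> J) \<subseteq> S" using J(2) by auto
        from 1 2 show "\<omega> \<in> ?U" by blast
      qed
    qed blast
    also have "\<dots> \<in> sigma_sets (configs N) (cylinders N UNIV)"
    proof -
      interpret sigma_algebra "configs N" "sigma_sets (configs N) (cylinders N (UNIV :: 'v set))"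
        by (intro sigma_algebra_sigma_sets) (auto simp: cylinders_def)
      have "countable ?I"
        by (rule countable_SIGMA[OF countable_Collect_finite_subset[OF assms]])
          (auto intro!: countable_finite finite_PiE)
      then have "countable {p \<in> ?I. ?C p \<subseteq> S}" by (rule countable_subset[rotated]) auto
      moreover have "?C p \<in> sigma_sets (configs N) (cylinders N UNIV)" if "p \<in> ?I" for p
      proof -
        obtain J w where p: "p = (J, w)" by (cases p)
        have "depends_on (\<lambda>\<eta>. \<forall>t\<in>J. \<eta> t = w t) J" by (auto simp: depends_on_def)
        with that p show ?thesis by (auto intro!: sigma_sets.Basic cylindersI[of J])
      qed
      ultimately show ?thesis by (intro countable_UN') auto
    qed
    finally show "S \<in> sigma_sets (configs N) (cylinders N UNIV)" .
  qed
  moreover have "cylinders N UNIV \<subseteq> ?O" using cylinder_open by blast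
  ultimately show ?thesis
    unfolding config_borel_def sets_measure_of[OF sub]
    by (intro equalityI sigma_sets_mono) (auto intro: sigma_sets.Basic)
qed

text \<open>Cylinders are closed as well as open, and the configuration space is compact by
  Tychonoff. This supplies continuity at the empty set for the extension theorem.\<close>

lemma decseq_cylinders_empty:
  assumes "range A \<subseteq> cylinders N U" "decseq A" "(\<Inter>i. A i) = {}"
  shows "\<exists>n. A n = {}"
proof (rule ccontr)
  assume ne: "\<nexists>n. A n = {}"
  have "compact_space (config_topology N)"
    unfolding config_topology_def compact_space_product_topology
    by (simp add: compact_space_discrete_topology)
  moreover have "closedin (config_topology N) (A n)" for n
  proof -
    have "A n \<in> cylinders N U" using assms(1) by auto
    then have "configs N - A n \<in> cylinders N U" "A n \<subseteq> configs N"
      using algebra_cylinders[of N U] by (auto simp: algebra_iff_Un)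
    then show ?thesis by (auto simp: closedin_def intro: cylinder_open)
  qed
  ultimately have "(\<Inter>i. A i) \<noteq> {}"
    using assms(2) ne by (intro compact_space_imp_nest) auto
  with assms(3) show False by simp
qed

text \<open>The sets that can be approximated form a sigma-algebra. For a countable union, the tail
  beyond finitely many sets has small measure and the remaining sets are approximated one by
  one.\<close>

lemma (in finite_measure) approx_by_algebra:
  assumes alg: "algebra (space M) \<A>" and sub: "\<A> \<subseteq> sets M"
    and A: "A \<in> sigma_sets (space M) \<A>" and "e > 0"
  shows "\<exists>B\<in>\<A>. measure M (sym_diff A B) < e"
  using A \<open>e > 0\<close>
proof (induction arbitrary: e rule: sigma_sets.induct)
  case (Basic a)
  then show ?case by (intro bexI[of _ a]) auto
next
  case Empty
  then show ?case using alg by (intro bexI[of _ "{}"]) (auto simp: algebra_iff_Un)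
next
  case (Compl a)
  then obtain B where B: "B \<in> \<A>" "measure M (sym_diff a B) < e" by blast
  have "\<A> \<subseteq> Pow (space M)" using alg by (simp add: algebra_iff_Un)
  then have "a \<subseteq> space M" using Compl.hyps by (rule sigma_sets_into_sp)
  moreover have "B \<subseteq> space M" using B(1) sub sets.sets_into_space by blast
  ultimately have "sym_diff (space M - a) (space M - B) = sym_diff a B" by auto
  with B alg show ?case by (intro bexI[of _ "space M - B"]) (auto simp: algebra_iff_Un)
next
  case (Union a)
  have sets: "a i \<in> sets M" for i
    using Union.hyps sets.sigma_sets_subset[OF sub] by auto
  let ?D = "\<lambda>n. (\<Union>i. a i) - (\<Union>i<n. a i)"
  have "(\<lambda>n. measure M (?D n)) \<longlonglongrightarrow> measure M (\<Inter>n. ?D n)"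
    using sets by (intro finite_Lim_measure_decseq) (auto simp: decseq_def)
  also have "(\<Inter>n. ?D n) = {}" by (auto intro: lessI)
  finally have "(\<lambda>n. measure M (?D n)) \<longlonglongrightarrow> 0" by simp
  then have "\<forall>\<^sub>F n in sequentially. measure M (?D n) < e / 2"
    by (rule order_tendstoD(2)) (use Union.prems in simp)
  then obtain n where n: "measure M (?D n) < e / 2" by (auto simp: eventually_sequentially)
  \<comment> \<open>The \<open>n\<close> errors add up to at most \<open>e / 2\<close>; taking
    \<open>n + 1\<close> keeps the denominator positive when \<open>n\<close> is 0.\<close>
  have "\<exists>B\<in>\<A>. measure M (sym_diff (a i) B) < e / (2 * (n + 1))" for i
    using Union.prems by (intro Union.IH) auto
  then obtain B where B: "\<And>i. B i \<in> \<A>" "\<And>i. measure M (sym_diff (a i) (B i)) < e / (2 * (n + 1))"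
    by metis
  have Bs: "B i \<in> sets M" for i using B(1) sub by auto
  interpret algebra "space M" \<A> by (rule alg)
  have UB: "(\<Union>i<n. B i) \<in> \<A>" using B(1) by (intro finite_UN) auto
  have "measure M (sym_diff (\<Union>i. a i) (\<Union>i<n. B i)) \<le>
      measure M (?D n \<union> (\<Union>i<n. sym_diff (a i) (B i)))"
    using sets Bs by (intro finite_measure_mono) auto
  also have "\<dots> \<le> measure M (?D n) + measure M (\<Union>i<n. sym_diff (a i) (B i))"
    using sets Bs by (intro measure_Un_le) auto
  also have "measure M (\<Union>i<n. sym_diff (a i) (B i)) \<le> (\<Sum>i<n. measure M (sym_diff (a i) (B i)))"
    using sets Bs by (intro measure_UNION_le) auto
  also have "\<dots> \<le> (\<Sum>i<n. e / (2 * (n + 1)))"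
    using B(2) by (intro sum_mono less_imp_le)
  also have "\<dots> \<le> e / 2"
    using Union.prems by (simp add: field_simps)
  finally have "measure M (sym_diff (\<Union>i. a i) (\<Union>i<n. B i)) < e" using n by linarith
  with UB show ?case by blast
qed

section \<open>The infinite-volume limit\<close>

lemma local_measurable:
  fixes f :: "('v \<Rightarrow> nat) \<Rightarrow> real"
  assumes "finite J" "J \<subseteq> U" "depends_on f J"
  shows "f \<in> borel_measurable (config_algebra N U)"
proof (rule measurableI)
  fix S :: "real set"
  have "depends_on (\<lambda>\<omega>. f \<omega> \<in> S) J" using assms(3) by (rule depends_on_comp)
  then have "{\<omega> \<in> configs N. f \<omega> \<in> S} \<in> sets (config_algebra N U)"
    using assms by (intro cylinder_in_config_algebra)
  also have "{\<omega> \<in> configs N. f \<omega> \<in> S} = f -` S \<inter> space (config_algebra N U)" by auto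
  finally show "f -` S \<inter> space (config_algebra N U) \<in> sets (config_algebra N U)" .
qed simp

text \<open>Reduces local functions to pattern indicators. Here \<open>f w\<close> is evaluated at
  an extensional \<open>w\<close>, which is legitimate because \<open>f\<close> looks only at
  \<open>J\<close>.\<close>

lemma local_decomposition:
  fixes f :: "('v \<Rightarrow> nat) \<Rightarrow> real"
  assumes "finite J" "depends_on f J" "\<omega> \<in> configs N"
  shows "f \<omega> = (\<Sum>w\<in>Pi\<^sub>E J (\<lambda>_. {1..N}). f w * of_bool (\<forall>t\<in>J. \<omega> t = w t))"
proof -
  let ?r = "restrict \<omega> J"
  have r: "?r \<in> (\<Pi>\<^sub>E s\<in>J. {1..N})" using assms(3) by (auto simp: configs_def)
  have "(\<Sum>w\<in>Pi\<^sub>E J (\<lambda>_. {1..N}). f w * of_bool (\<forall>t\<in>J. \<omega> t = w t)) =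
      (\<Sum>w\<in>Pi\<^sub>E J (\<lambda>_. {1..N}). if w = ?r then f w else 0)"
    by (intro sum.cong refl) (auto simp: fun_eq_iff PiE_def extensional_def)
  also have "\<dots> = f ?r" using r assms(1) by (simp add: finite_PiE)
  also have "\<dots> = f \<omega>" using assms(2) by (rule depends_onD) simp
  finally show ?thesis ..
qed

lemma restrict_eq_iff: "w \<in> Pi\<^sub>E \<Lambda> E \<Longrightarrow> restrict \<eta> \<Lambda> = w \<longleftrightarrow> (\<forall>t\<in>\<Lambda>. \<eta> t = w t)"
  by (auto simp: fun_eq_iff PiE_def extensional_def)

context potts begin

text \<open>The bridge between the operator \<open>G\<close> and the ratio prescribed by
  \<open>realizing_gibbs\<close>: only the summand \<open>v = w\<close> survives.\<close>

lemma G_atom: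
  assumes "finite \<Lambda>" "w \<in> cfg \<Lambda>"
  shows "G \<Lambda> (\<lambda>\<eta>. of_bool (\<forall>t\<in>\<Lambda>. \<eta> t = w t)) \<omega> = exp (- H \<Lambda> (override_on \<omega> w \<Lambda>)) / Z \<Lambda> \<omega>"
proof -
  have "(\<Sum>v\<in>cfg \<Lambda>. exp (- H \<Lambda> (override_on \<omega> v \<Lambda>)) * of_bool (\<forall>t\<in>\<Lambda>. override_on \<omega> v \<Lambda> t = w t))
      = (\<Sum>v\<in>cfg \<Lambda>. if v = w then exp (- H \<Lambda> (override_on \<omega> v \<Lambda>)) else 0)"
  proof (intro sum.cong refl)
    fix v assume "v \<in> cfg \<Lambda>"
    then have "(\<forall>t\<in>\<Lambda>. override_on \<omega> v \<Lambda> t = w t) \<longleftrightarrow> v = w"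
      using PiE_ext[OF _ assms(2), of v] by auto
    then show "exp (- H \<Lambda> (override_on \<omega> v \<Lambda>)) * of_bool (\<forall>t\<in>\<Lambda>. override_on \<omega> v \<Lambda> t = w t) =
        (if v = w then exp (- H \<Lambda> (override_on \<omega> v \<Lambda>)) else 0)" by simp
  qed
  also have "\<dots> = exp (- H \<Lambda> (override_on \<omega> w \<Lambda>))"
    using assms by (simp add: finite_PiE)
  finally show ?thesis by (simp add: G_def)
qed

definition outer :: "'v set \<Rightarrow> 'v set" where
  "outer \<Lambda> = \<Union> (edges_at adj \<Lambda>) - \<Lambda>"

lemma finite_outer: "finite \<Lambda> \<Longrightarrow> finite (outer \<Lambda>)"
  unfolding outer_def
  by (intro finite_Diff finite_Union finite_edges_at) (auto simp: edges_at_def)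

text \<open>The interaction has range one, so the kernel sees the outside of
  \<open>\<Lambda>\<close> only through \<open>f\<close> and the outer boundary. Hence it maps local
  functions to local functions.\<close>

lemma depends_on_G:
  assumes "finite \<Lambda>" "depends_on f J"
  shows "depends_on (G \<Lambda> f) ((J - \<Lambda>) \<union> outer \<Lambda>)"
  unfolding depends_on_def
proof (intro allI impI)
  fix \<omega> \<omega>' :: "'v \<Rightarrow> nat" assume *: "\<forall>t\<in>(J - \<Lambda>) \<union> outer \<Lambda>. \<omega> t = \<omega>' t"
  have "H \<Lambda> (override_on \<omega> w \<Lambda>) = H \<Lambda> (override_on \<omega>' w \<Lambda>)" for w
    unfolding hamiltonian_eq_sum[OF assms(1)]
  proof (intro sum.cong refl potts_potential_cong)
    fix \<Delta> t assume "\<Delta> \<in> edges_at adj \<Lambda>" "t \<in> \<Delta>"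
    then have "t \<in> \<Lambda> \<union> outer \<Lambda>" by (auto simp: outer_def)
    with * show "override_on \<omega> w \<Lambda> t = override_on \<omega>' w \<Lambda> t" by (auto simp: override_on_def)
  qed
  moreover have "f (override_on \<omega> w \<Lambda>) = f (override_on \<omega>' w \<Lambda>)" for w
    using assms(2) by (rule depends_onD) (use * in \<open>auto simp: override_on_def\<close>)
  ultimately show "G \<Lambda> f \<omega> = G \<Lambda> f \<omega>'" by (simp add: G_def partition_fun_def)
qed

end

locale potts_unique = potts adj d N \<beta>
  for adj :: "'v \<Rightarrow> 'v \<Rightarrow> bool" and d N :: nat and \<beta> :: real +
  assumes connected: "connected_graph adj" and \<theta>_less: "\<theta> < 1"
begin

section \<open>Exhaustion of the graph by finite balls\<close>

lemma finite_ball: "finite (ball_of s n)"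
proof -
  have "finite {t. (adj ^^ k) s t}" for k
  proof (induction k)
    case (Suc k)
    have "{t. (adj ^^ Suc k) s t} = (\<Union>u\<in>{u. (adj ^^ k) s u}. {t. adj u t})" by auto
    with Suc finite_nbrs show ?case by simp
  qed simp
  moreover have "ball_of s n = (\<Union>k\<le>n. {t. (adj ^^ k) s t})" by (auto simp: ball_of_def)
  ultimately show ?thesis by simp
qed

lemma walk_exists: "\<exists>k. (adj ^^ k) s t"
  using connected by (auto simp: connected_graph_def rtranclp_power)

lemma countable_vertices: "countable (UNIV :: 'v set)"
proof -
  have "(UNIV :: 'v set) = (\<Union>n. ball_of undefined n)"
    using walk_exists by (fastforce simp: ball_of_def)
  then show ?thesis using finite_ball by (metis countable_UN countable_finite countableI_type)
qed

text \<open>The root \<open>undefined\<close> is an arbitrary vertex.\<close>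

definition patch :: "nat \<Rightarrow> 'v set" where "patch n = ball_of undefined n"

lemma finite_patch: "finite (patch n)"
  by (simp add: patch_def finite_ball)

lemma patch_mono: "m \<le> n \<Longrightarrow> patch m \<subseteq> patch n"
  by (auto simp: patch_def ball_of_def intro: order_trans)

lemma patch_exhausts:
  assumes "finite J"
  shows "\<exists>M. \<forall>s\<in>J. ball_of s n \<subseteq> patch M"
  using assms
proof (induction J)
  case (insert s J)
  then obtain M where M: "\<forall>s\<in>J. ball_of s n \<subseteq> patch M" by blast
  obtain k where k: "(adj ^^ k) undefined s" using walk_exists by blast
  \<comment> \<open>Triangle inequality: a walk of length \<open>k\<close> from the root to
    \<open>s\<close> is prolonged by at most \<open>n\<close> steps.\<close>
  have "ball_of s n \<subseteq> patch (k + n)"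
  proof
    fix t assume "t \<in> ball_of s n"
    then obtain j where "j \<le> n" "(adj ^^ j) s t" by (auto simp: ball_of_def)
    with k have "(adj ^^ (k + j)) undefined t" "k + j \<le> k + n" by (auto simp: relpowp_add)
    then show "t \<in> patch (k + n)" unfolding patch_def ball_of_def by blast
  qed
  then have "\<forall>s\<in>insert s J. ball_of s n \<subseteq> patch (max M (k + n))"
    using M patch_mono[of M "max M (k + n)"] patch_mono[of "k + n" "max M (k + n)"] by auto
  then show ?case by blast
qed simp

lemma patch_exhausts_set:
  assumes "finite J"
  shows "\<forall>\<^sub>F m in sequentially. J \<subseteq> patch m"
proof -
  obtain M where "\<forall>s\<in>J. ball_of s 0 \<subseteq> patch M" using patch_exhausts[OF assms] by blast
  then have "J \<subseteq> patch M" using self_in_ball by blast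
  then show ?thesis using patch_mono unfolding eventually_sequentially by blast
qed

text \<open>By consistency the larger volume averages \<open>G \<Lambda> g\<close> over boundary
  conditions, and all these values lie close to each other. Both volume and boundary condition may
  therefore change.\<close>

lemma G_close:
  assumes "finite \<Lambda>'" "\<Lambda> \<subseteq> \<Lambda>'" "finite J" "depends_on g J" and g: "\<And>\<omega>. 0 \<le> g \<omega> \<and> g \<omega> \<le> 1"
    and ball: "\<And>s. s \<in> J \<Longrightarrow> ball_of s n \<subseteq> \<Lambda>"
  shows "\<bar>G \<Lambda>' g \<omega>' - G \<Lambda> g \<omega>\<bar> \<le> card J * \<theta> ^ n"
proof -
  have fin: "finite \<Lambda>" using assms(1,2) finite_subset by blast
  have *: "\<bar>G \<Lambda> g \<zeta> - G \<Lambda> g \<omega>\<bar> \<le> card J * \<theta> ^ n" for \<zeta>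
    using ball by (intro influence_local[OF fin assms(3,4) g]) auto
  have "G \<Lambda>' (G \<Lambda> g) \<omega>' \<le> G \<Lambda> g \<omega> + card J * \<theta> ^ n"
    using * by (intro G_le[OF assms(1)]) (smt (verit))
  moreover have "G \<Lambda> g \<omega> - card J * \<theta> ^ n \<le> G \<Lambda>' (G \<Lambda> g) \<omega>'"
    using * by (intro G_ge[OF assms(1)]) (smt (verit))
  ultimately show ?thesis by (simp add: G_comp[OF assms(1,2)] abs_le_iff)
qed

lemma influence_small:
  assumes "e > 0"
  shows "\<exists>n. c * \<theta> ^ n < e"
proof -
  have "(\<lambda>n. c * \<theta> ^ n) \<longlonglongrightarrow> c * 0"
    using \<theta>_less \<theta>_pos by (intro tendsto_mult_left LIMSEQ_realpow_zero) auto
  then have "\<forall>\<^sub>F n in sequentially. c * \<theta> ^ n < e"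
    by (rule order_tendstoD(2)) (use assms in simp)
  then show ?thesis by (auto simp: eventually_sequentially)
qed

abbreviation ones :: "'v \<Rightarrow> nat" where "ones \<equiv> (\<lambda>_. 1)"

lemma ones_in_configs: "ones \<in> configs N"
  using many_states by (auto simp: in_configs)

lemma G_convergent:
  assumes "finite J" "depends_on g J" "\<And>\<omega>. 0 \<le> g \<omega> \<and> g \<omega> \<le> 1"
  shows "convergent (\<lambda>m. G (patch m) g ones)"
proof (rule Cauchy_convergent, rule metric_CauchyI)
  fix e :: real assume "e > 0"
  then obtain n where n: "card J * \<theta> ^ n < e / 2" using influence_small[of "e / 2"] by auto
  obtain M where M: "\<forall>s\<in>J. ball_of s n \<subseteq> patch M" using patch_exhausts[OF assms(1)] by blast
  have close: "\<bar>G (patch m) g ones - G (patch M) g ones\<bar> < e / 2" if "m \<ge> M" for m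
    using G_close[OF finite_patch patch_mono[OF that] assms, of n ones ones] M n by auto
  have "dist (G (patch m) g ones) (G (patch m') g ones) < e" if "m \<ge> M" "m' \<ge> M" for m m'
    using close[OF that(1)] close[OF that(2)] unfolding dist_real_def by linarith
  then show "\<exists>M. \<forall>m\<ge>M. \<forall>m'\<ge>M. dist (G (patch m) g ones) (G (patch m') g ones) < e" by blast
qed

section \<open>Construction of the limit measure\<close>

lemma G_indicator:
  fixes P :: "('v \<Rightarrow> nat) \<Rightarrow> bool"
  assumes "\<omega> \<in> configs N"
  shows "G \<Lambda> (indicator {\<omega> \<in> configs N. P \<omega>}) \<omega> = G \<Lambda> (\<lambda>\<omega>. of_bool (P \<omega>)) \<omega>"
  using override_in_configs[OF assms] by (intro G_cong) (simp add: indicator_def)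

definition lim_prob :: "('v \<Rightarrow> nat) set \<Rightarrow> real" where
  "lim_prob A = lim (\<lambda>m. G (patch m) (indicator A) ones)"

lemma lim_prob:
  assumes "A \<in> cylinders N UNIV"
  shows "(\<lambda>m. G (patch m) (indicator A) ones) \<longlonglongrightarrow> lim_prob A"
proof -
  from assms obtain P J where A: "A = {\<omega> \<in> configs N. P \<omega>}" "finite J" "depends_on P J"
    by (rule cylindersE)
  have "convergent (\<lambda>m. G (patch m) (\<lambda>\<omega>. of_bool (P \<omega>)) ones)"
    using A(2) by (rule G_convergent) (use A(3) in \<open>auto intro: depends_on_comp\<close>)
  then have "convergent (\<lambda>m. G (patch m) (indicator A) ones)"
    unfolding A(1) G_indicator[OF ones_in_configs] .
  then show ?thesis unfolding lim_prob_def by (rule convergent_LIMSEQ_iff[THEN iffD1])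
qed

text \<open>Limits of finite-volume probabilities are finitely additive on cylinders. A decreasing
  sequence of cylinders with empty intersection is eventually empty by compactness, so continuity at
  the empty set is immediate and Caratheodory's theorem applies.\<close>

lemma exists_limit_measure:
  "\<exists>\<mu>. prob_space \<mu> \<and> space \<mu> = configs N \<and> sets \<mu> = sets (config_borel N) \<and>
     (\<forall>A\<in>cylinders N UNIV. (\<lambda>m. G (patch m) (indicator A) ones) \<longlonglongrightarrow> measure \<mu> A)"
proof -
  let ?C = "cylinders N (UNIV :: 'v set)"
  interpret algebra "configs N" ?C by (rule algebra_cylinders)
  define f where "f A = ennreal (lim_prob A)" for A
  have nonneg: "lim_prob A \<ge> 0" if "A \<in> ?C" for A
    using lim_prob[OF that] by (rule LIMSEQ_le_const) (auto intro!: exI G_ge finite_patch)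
  have empty: "lim_prob {} = 0"
  proof -
    have "(\<lambda>m. G (patch m) (indicator {}) ones) \<longlonglongrightarrow> 0"
    proof -
      have "(indicator {} :: ('v \<Rightarrow> nat) \<Rightarrow> real) = (\<lambda>_. 0)" by (simp add: fun_eq_iff)
      then show ?thesis by (simp add: G_const finite_patch)
    qed
    with lim_prob[of "{}"] show ?thesis using LIMSEQ_unique by auto
  qed
  have top: "lim_prob (configs N) = 1"
  proof -
    have "G (patch m) (indicator (configs N)) ones = 1" for m
      using G_indicator[OF ones_in_configs, of "patch m" "\<lambda>_. True"] finite_patch by (simp add: G_const)
    then have "(\<lambda>m. G (patch m) (indicator (configs N)) ones) \<longlonglongrightarrow> 1" by simp
    with lim_prob[OF top] show ?thesis using LIMSEQ_unique by auto
  qed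
  have add: "lim_prob (A \<union> B) = lim_prob A + lim_prob B"
    if "A \<in> ?C" "B \<in> ?C" "A \<inter> B = {}" for A B
  proof -
    have "G (patch m) (indicator (A \<union> B)) ones =
        G (patch m) (indicator A) ones + G (patch m) (indicator B) ones" for m
      unfolding G_add[symmetric] using that(3) by (intro G_cong) (auto simp: indicator_def)
    then have "(\<lambda>m. G (patch m) (indicator (A \<union> B)) ones) \<longlonglongrightarrow> lim_prob A + lim_prob B"
      using tendsto_add[OF lim_prob[OF that(1)] lim_prob[OF that(2)]] by simp
    with lim_prob[of "A \<union> B"] that show ?thesis using LIMSEQ_unique by auto
  qed
  have "\<exists>\<mu> :: _ \<Rightarrow> ennreal. (\<forall>s \<in> ?C. \<mu> s = f s) \<and>
      measure_space (configs N) (sigma_sets (configs N) ?C) \<mu>"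
  proof (rule caratheodory_empty_continuous)
    show "positive ?C f" by (simp add: positive_def f_def empty)
    show "additive ?C f"
      by (auto simp: additive_def f_def add nonneg)
    show "f A \<noteq> \<infinity>" for A by (simp add: f_def)
    fix A :: "nat \<Rightarrow> _" assume A: "range A \<subseteq> ?C" "decseq A" "(\<Inter>i. A i) = {}"
    then obtain n where "A n = {}" using decseq_cylinders_empty by blast
    then have "A m = {}" if "m \<ge> n" for m using A(2) that by (auto dest: decseqD)
    then have "\<forall>\<^sub>F m in sequentially. f (A m) = 0"
      by (auto simp: eventually_sequentially f_def empty intro!: exI[of _ n])
    then show "(\<lambda>i. f (A i)) \<longlonglongrightarrow> 0" by (rule tendsto_eventually)
  qed
  then obtain m where m: "\<And>A. A \<in> ?C \<Longrightarrow> m A = f A"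
    "measure_space (configs N) (sigma_sets (configs N) ?C) m" by blast
  define \<mu> where "\<mu> = measure_of (configs N) (sigma_sets (configs N) ?C) m"
  have sub: "sigma_sets (configs N) ?C \<subseteq> Pow (configs N)"
    using sigma_sets_into_sp[OF space_closed] by auto
  have space: "space \<mu> = configs N" unfolding \<mu>_def by (rule space_measure_of[OF sub])
  have sets: "sets \<mu> = sigma_sets (configs N) ?C"
    unfolding \<mu>_def sets_measure_of[OF sub] by (rule sigma_sets_sigma_sets_eq[OF space_closed])
  have em: "emeasure \<mu> A = f A" if "A \<in> ?C" for A
    unfolding \<mu>_def using m that
    by (subst emeasure_measure_of_sigma) (auto simp: measure_space_def)
  have "prob_space \<mu>"
    by (rule prob_spaceI) (simp add: space em f_def top)
  moreover have "measure \<mu> A = lim_prob A" if "A \<in> ?C" for A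
    using em[OF that] nonneg[OF that] by (simp add: measure_def f_def)
  ultimately show ?thesis
    using space sets lim_prob sets_config_borel[OF countable_vertices, of N] by auto
qed

end

section \<open>The limit is a Gibbs measure\<close>

lemma depends_on_pattern: "depends_on (\<lambda>\<omega>. \<forall>t\<in>J. \<omega> t = w t) J"
  by (auto simp: depends_on_def)

lemma pattern_cylinder:
  assumes "finite J" "J \<subseteq> U"
  shows "{\<omega> \<in> configs N. \<forall>t\<in>J. \<omega> t = w t} \<in> cylinders N U"
  using assms depends_on_pattern by (rule cylindersI)

locale potts_limit = potts_unique adj d N \<beta> + prob_space \<mu>
  for adj :: "'v \<Rightarrow> 'v \<Rightarrow> bool" and d N :: nat and \<beta> :: real and \<mu> :: "('v \<Rightarrow> nat) measure" +
  assumes space_\<mu>: "space \<mu> = configs N" and sets_\<mu>: "sets \<mu> = sets (config_borel N)"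
    and lim_\<mu>: "\<And>A. A \<in> cylinders N UNIV \<Longrightarrow> (\<lambda>m. G (patch m) (indicator A) ones) \<longlonglongrightarrow> measure \<mu> A"
begin

lemma config_algebra_subset: "sets (config_algebra N U) \<subseteq> sets (config_borel N :: ('v \<Rightarrow> nat) measure)"
  unfolding sets_config_algebra sets_config_borel[OF countable_vertices]
  by (intro sigma_sets_mono' cylinders_mono) auto

text \<open>On configurations a local function is determined by finitely many patterns, hence
  bounded. The measure \<open>\<nu>\<close> is arbitrary because uniqueness applies this to a
  competing Gibbs measure.\<close>

lemma local_integrable:
  fixes f :: "('v \<Rightarrow> nat) \<Rightarrow> real" and \<nu> :: "('v \<Rightarrow> nat) measure"
  assumes "prob_space \<nu>" "space \<nu> = configs N" "sets \<nu> = sets (config_borel N)"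
    and J: "finite J" "depends_on f J"
  shows "integrable \<nu> f"
proof -
  interpret \<nu>: prob_space \<nu> by fact
  have "f \<in> borel_measurable (config_algebra N UNIV)" using J by (intro local_measurable) auto
  then have "f \<in> borel_measurable \<nu>"
    using config_algebra_subset[of UNIV] assms(2,3) by (auto simp: measurable_def)
  moreover have "\<bar>f \<omega>\<bar> \<le> (\<Sum>w\<in>cfg J. \<bar>f w\<bar>)" if "\<omega> \<in> configs N" for \<omega>
  proof -
    have "\<bar>f \<omega>\<bar> \<le> (\<Sum>w\<in>cfg J. \<bar>f w * of_bool (\<forall>t\<in>J. \<omega> t = w t)\<bar>)"
      unfolding local_decomposition[OF J that] by (rule sum_abs)
    also have "\<dots> \<le> (\<Sum>w\<in>cfg J. \<bar>f w\<bar>)" by (intro sum_mono) auto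
    finally show ?thesis .
  qed
  ultimately show ?thesis
    by (intro \<nu>.integrable_const_bound[where B = "\<Sum>w\<in>cfg J. \<bar>f w\<bar>"]) (auto simp: assms(2))
qed

lemma integral_of_bool:
  fixes P :: "('v \<Rightarrow> nat) \<Rightarrow> bool" and \<nu> :: "('v \<Rightarrow> nat) measure"
  assumes "space \<nu> = configs N"
  shows "(\<integral>\<omega>. of_bool (P \<omega>) \<partial>\<nu>) = measure \<nu> {\<omega> \<in> configs N. P \<omega>}"
proof -
  have "(\<integral>\<omega>. of_bool (P \<omega>) \<partial>\<nu>) = (\<integral>\<omega>. indicator {\<omega> \<in> configs N. P \<omega>} \<omega> \<partial>\<nu>)"
    by (intro Bochner_Integration.integral_cong refl) (simp add: assms indicator_def)
  also have "\<dots> = measure \<nu> ({\<omega> \<in> configs N. P \<omega>} \<inter> space \<nu>)" by simp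
  also have "{\<omega> \<in> configs N. P \<omega>} \<inter> space \<nu> = {\<omega> \<in> configs N. P \<omega>}" using assms by auto
  finally show ?thesis .
qed

lemma integral_local_eq_sum:
  fixes f :: "('v \<Rightarrow> nat) \<Rightarrow> real" and \<nu> :: "('v \<Rightarrow> nat) measure"
  assumes "prob_space \<nu>" "space \<nu> = configs N" "sets \<nu> = sets (config_borel N)"
    and J: "finite J" "depends_on f J"
  shows "(\<integral>\<omega>. f \<omega> \<partial>\<nu>) = (\<Sum>w\<in>cfg J. f w * measure \<nu> {\<omega> \<in> configs N. \<forall>t\<in>J. \<omega> t = w t})"
proof -
  have int: "integrable \<nu> (\<lambda>\<omega>. of_bool (\<forall>t\<in>J. \<omega> t = w t) :: real)" for w
    using depends_on_comp[OF depends_on_pattern] J(1) by (intro local_integrable assms)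
  have "(\<integral>\<omega>. f \<omega> \<partial>\<nu>) = (\<integral>\<omega>. (\<Sum>w\<in>cfg J. f w * of_bool (\<forall>t\<in>J. \<omega> t = w t)) \<partial>\<nu>)"
    by (intro Bochner_Integration.integral_cong refl local_decomposition[OF J]) (simp add: assms)
  also have "\<dots> = (\<Sum>w\<in>cfg J. f w * measure \<nu> {\<omega> \<in> configs N. \<forall>t\<in>J. \<omega> t = w t})"
    using int by (simp add: Bochner_Integration.integral_sum integral_of_bool[OF assms(2)])
  finally show ?thesis .
qed

text \<open>Finite linearity carries the convergence from patterns on \<open>J\<close> to every
  function of the states on \<open>J\<close>.\<close>

lemma integral_local_lim:
  fixes f :: "('v \<Rightarrow> nat) \<Rightarrow> real"
  assumes J: "finite J" "depends_on f J"
  shows "(\<lambda>m. G (patch m) f ones) \<longlonglongrightarrow> (\<integral>\<omega>. f \<omega> \<partial>\<mu>)"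
proof -
  let ?C = "\<lambda>w. {\<omega> \<in> configs N. \<forall>t\<in>J. \<omega> t = w t}"
  have eq: "G (patch m) f ones = (\<Sum>w\<in>cfg J. f w * G (patch m) (indicator (?C w)) ones)" for m
  proof -
    have "G (patch m) f ones = G (patch m) (\<lambda>\<omega>. \<Sum>w\<in>cfg J. f w * indicator (?C w) \<omega>) ones"
    proof (rule G_cong)
      fix w assume "w \<in> cfg (patch m)"
      then have *: "override_on ones w (patch m) \<in> configs N"
        by (rule override_in_configs[OF ones_in_configs])
      show "f (override_on ones w (patch m)) =
          (\<Sum>v\<in>cfg J. f v * indicator (?C v) (override_on ones w (patch m)))"
        unfolding local_decomposition[OF J *] using *
        by (intro sum.cong refl) (simp add: indicator_def)
    qed
    then show ?thesis by (simp add: G_sum G_cmult)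
  qed
  have "prob_space \<mu>" by unfold_locales
  then have "(\<integral>\<omega>. f \<omega> \<partial>\<mu>) = (\<Sum>w\<in>cfg J. f w * measure \<mu> (?C w))"
    using space_\<mu> sets_\<mu> J by (rule integral_local_eq_sum)
  then show ?thesis
    unfolding eq using J(1) by (simp only:) (intro tendsto_intros lim_\<mu> pattern_cylinder subset_UNIV)
qed

text \<open>As soon as the patch contains \<open>\<Lambda>\<close>, consistency makes the two
  finite-volume expectations equal, because \<open>g\<close> does not look at
  \<open>\<Lambda>\<close>. Both integrands are local, so the equality passes to the limit.\<close>

lemma DLR_local:
  assumes "finite \<Lambda>" "finite J" "depends_on f J" "finite K" "K \<inter> \<Lambda> = {}" "depends_on g K"
  shows "(\<integral>\<omega>. g \<omega> * G \<Lambda> f \<omega> \<partial>\<mu>) = (\<integral>\<omega>. g \<omega> * f \<omega> \<partial>\<mu>)"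
proof (rule LIMSEQ_unique)
  have "depends_on (\<lambda>\<omega>. g \<omega> * G \<Lambda> f \<omega>) (K \<union> ((J - \<Lambda>) \<union> outer \<Lambda>))"
    using assms(6) depends_on_G[OF assms(1,3)] by (rule depends_on_comp2)
  then show "(\<lambda>m. G (patch m) (\<lambda>\<omega>. g \<omega> * G \<Lambda> f \<omega>) ones) \<longlonglongrightarrow> (\<integral>\<omega>. g \<omega> * G \<Lambda> f \<omega> \<partial>\<mu>)"
    using assms finite_outer by (intro integral_local_lim) auto
  have "depends_on (\<lambda>\<omega>. g \<omega> * f \<omega>) (K \<union> J)" using assms(6,3) by (rule depends_on_comp2)
  then have "(\<lambda>m. G (patch m) (\<lambda>\<omega>. g \<omega> * f \<omega>) ones) \<longlonglongrightarrow> (\<integral>\<omega>. g \<omega> * f \<omega> \<partial>\<mu>)"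
    using assms by (intro integral_local_lim) auto
  moreover have "\<forall>\<^sub>F m in sequentially.
      G (patch m) (\<lambda>\<omega>. g \<omega> * f \<omega>) ones = G (patch m) (\<lambda>\<omega>. g \<omega> * G \<Lambda> f \<omega>) ones"
    using patch_exhausts_set[OF assms(1)]
  proof eventually_elim
    case (elim m)
    have "G (patch m) (\<lambda>\<omega>. g \<omega> * f \<omega>) ones = G (patch m) (G \<Lambda> (\<lambda>\<omega>. g \<omega> * f \<omega>)) ones"
      using finite_patch elim by (rule G_comp[symmetric])
    also have "\<dots> = G (patch m) (\<lambda>\<omega>. g \<omega> * G \<Lambda> f \<omega>) ones"
      using assms(5) by (intro G_cong G_pull_out depends_onD[OF assms(6)]) auto
    finally show ?case .
  qed
  ultimately show "(\<lambda>m. G (patch m) (\<lambda>\<omega>. g \<omega> * G \<Lambda> f \<omega>) ones) \<longlonglongrightarrow> (\<integral>\<omega>. g \<omega> * f \<omega> \<partial>\<mu>)"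
    by (rule Lim_transform_eventually)
qed

section \<open>From cylinders to all events off a finite volume\<close>

lemma subalgebra_config: "subalgebra \<mu> (config_algebra N U)"
  using config_algebra_subset sets_\<mu> space_\<mu> by (auto simp: subalgebra_def)

lemma approx_by_cylinder:
  assumes "A \<in> sets (config_algebra N U)" "e > 0"
  shows "\<exists>B\<in>cylinders N U. measure \<mu> (sym_diff A B) < e"
proof (rule approx_by_algebra)
  show "algebra (space \<mu>) (cylinders N U)" unfolding space_\<mu> by (rule algebra_cylinders)
  have "cylinders N U \<subseteq> sets (config_algebra N U)" unfolding sets_config_algebra by auto
  also have "\<dots> \<subseteq> sets \<mu>" using subalgebra_config by (simp add: subalgebra_def)
  finally show "cylinders N U \<subseteq> sets \<mu>" .
qed (use assms in \<open>simp_all add: space_\<mu> sets_config_algebra\<close>)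

lemma cylinder_sets: "A \<in> cylinders N U \<Longrightarrow> A \<in> sets (config_algebra N U)"
  by (simp add: sets_config_algebra sigma_sets.Basic)

lemma config_algebra_sets: "A \<in> sets (config_algebra N U) \<Longrightarrow> A \<in> sets \<mu>"
  using subalgebra_config[of U] by (auto simp: subalgebra_def)

text \<open>As \<open>q\<close> is bounded by 1, replacing \<open>A\<close> by a cylinder changes
  the integral by at most the measure of the symmetric difference. The DLR equation, known against
  cylinders, is thereby tested against every event outside the volume.\<close>

lemma set_integral_zero_extend:
  fixes q :: "('v \<Rightarrow> nat) \<Rightarrow> real"
  assumes q: "integrable \<mu> q" "\<And>\<omega>. \<omega> \<in> configs N \<Longrightarrow> \<bar>q \<omega>\<bar> \<le> 1"
    and cyl: "\<And>B. B \<in> cylinders N U \<Longrightarrow> (\<integral>\<omega>. indicator B \<omega> * q \<omega> \<partial>\<mu>) = 0"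
    and A: "A \<in> sets (config_algebra N U)"
  shows "(\<integral>\<omega>. indicator A \<omega> * q \<omega> \<partial>\<mu>) = 0"
proof (rule ccontr)
  assume "(\<integral>\<omega>. indicator A \<omega> * q \<omega> \<partial>\<mu>) \<noteq> 0"
  then obtain B where B: "B \<in> cylinders N U"
    "measure \<mu> (sym_diff A B) < \<bar>\<integral>\<omega>. indicator A \<omega> * q \<omega> \<partial>\<mu>\<bar>"
    using approx_by_cylinder[OF A, of "\<bar>\<integral>\<omega>. indicator A \<omega> * q \<omega> \<partial>\<mu>\<bar>"] by auto
  have sets: "A \<in> sets \<mu>" "B \<in> sets \<mu>" using A cylinder_sets[OF B(1)] config_algebra_sets by auto
  have int: "integrable \<mu> (\<lambda>\<omega>. indicator S \<omega> * q \<omega>)" if "S \<in> sets \<mu>" for S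
    using integrable_mult_indicator[OF that q(1)] by simp
  have "\<bar>\<integral>\<omega>. indicator A \<omega> * q \<omega> \<partial>\<mu>\<bar> =
      \<bar>\<integral>\<omega>. indicator A \<omega> * q \<omega> - indicator B \<omega> * q \<omega> \<partial>\<mu>\<bar>"
    using int sets cyl[OF B(1)] by simp
  also have "\<dots> \<le> (\<integral>\<omega>. \<bar>indicator A \<omega> * q \<omega> - indicator B \<omega> * q \<omega>\<bar> \<partial>\<mu>)"
    by (rule integral_abs_bound)
  also have "\<dots> \<le> (\<integral>\<omega>. indicator (sym_diff A B) \<omega> \<partial>\<mu>)"
  proof (rule integral_mono)
    show "integrable \<mu> (\<lambda>\<omega>. \<bar>indicator A \<omega> * q \<omega> - indicator B \<omega> * q \<omega>\<bar>)"
      using int sets by (intro integrable_abs Bochner_Integration.integrable_diff)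
    show "integrable \<mu> (indicator (sym_diff A B) :: _ \<Rightarrow> real)"
      using sets by (intro integrable_real_indicator) (auto simp: emeasure_eq_measure)
    show "\<bar>indicator A \<omega> * q \<omega> - indicator B \<omega> * q \<omega>\<bar> \<le> indicator (sym_diff A B) \<omega>"
      if "\<omega> \<in> space \<mu>" for \<omega>
      using q(2)[of \<omega>] that by (auto simp: space_\<mu> indicator_def)
  qed
  also have "\<dots> = measure \<mu> (sym_diff A B)"
    using sets sets.sets_into_space by (simp add: Int_absorb2)
  finally show False using B(2) by simp
qed

text \<open>The candidate for the conditional probability is \<open>G \<Lambda> ?f\<close>. It
  depends on the outer boundary only, hence is measurable off \<open>\<Lambda>\<close>, and
  \<open>DLR_local\<close> gives the defining identity of conditional expectation on
  cylinders.\<close>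

lemma realizing: "realizing_gibbs N (potts_potential adj \<beta>) \<mu>"
  unfolding realizing_gibbs_def
proof (intro conjI allI impI)
  show "prob_space \<mu>" by unfold_locales
  show "space \<mu> = configs N" by (rule space_\<mu>)
  show "sets \<mu> = sets (config_borel N)" by (rule sets_\<mu>)
  fix \<Lambda> :: "'v set" and w assume \<Lambda>: "finite \<Lambda>" and w: "w \<in> cfg \<Lambda>"
  let ?F = "config_algebra N (- \<Lambda>)" and ?f = "\<lambda>\<eta>. of_bool (\<forall>t\<in>\<Lambda>. \<eta> t = w t) :: real"
  let ?C = "indicator {\<eta> \<in> configs N. restrict \<eta> \<Lambda> = w} :: _ \<Rightarrow> real"
  interpret sigma_finite_subalgebra \<mu> ?F
    using subalgebra_config by (intro finite_measure_subalgebra_is_sigma_finite)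
      (unfold_locales, auto)
  have dep: "depends_on ?f \<Lambda>" by (rule depends_on_comp[OF depends_on_pattern])
  have C: "?C \<eta> = ?f \<eta>" if "\<eta> \<in> configs N" for \<eta>
    using that restrict_eq_iff[OF w] by (simp add: indicator_def)
  have depG: "depends_on (G \<Lambda> ?f) (outer \<Lambda>)" using depends_on_G[OF \<Lambda> dep] by simp
  have ps: "prob_space \<mu>" by unfold_locales
  note intl = local_integrable[OF ps space_\<mu> sets_\<mu>]
  have int: "integrable \<mu> ?f" "integrable \<mu> (G \<Lambda> ?f)"
    using intl[OF \<Lambda> dep] intl[OF finite_outer[OF \<Lambda>] depG] .
  have intC: "integrable \<mu> ?C"
    using int(1) by (rule Bochner_Integration.integrable_cong[THEN iffD1, rotated 2])
      (simp_all add: space_\<mu> C)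
  have "AE \<omega> in \<mu>. real_cond_exp \<mu> ?F ?C \<omega> = G \<Lambda> ?f \<omega>"
  proof (rule real_cond_exp_charact)
    show "integrable \<mu> ?C" "integrable \<mu> (G \<Lambda> ?f)" by fact+
    show "G \<Lambda> ?f \<in> borel_measurable ?F"
      using depG finite_outer[OF \<Lambda>] by (intro local_measurable) (auto simp: outer_def)
    fix A assume A: "A \<in> sets ?F"
    have As: "A \<in> sets \<mu>" using A by (rule config_algebra_sets)
    have intA: "integrable \<mu> (\<lambda>\<omega>. indicator A \<omega> * h \<omega>)" if "integrable \<mu> h" for h :: "_ \<Rightarrow> real"
      using integrable_mult_indicator[OF As that] by simp
    have "(\<integral>\<omega>. indicator A \<omega> * (?f \<omega> - G \<Lambda> ?f \<omega>) \<partial>\<mu>) = 0"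
    proof (rule set_integral_zero_extend[OF _ _ _ A])
      show "integrable \<mu> (\<lambda>\<omega>. ?f \<omega> - G \<Lambda> ?f \<omega>)" using int by simp
      fix \<omega>
      have "0 \<le> G \<Lambda> ?f \<omega>" "G \<Lambda> ?f \<omega> \<le> 1" using \<Lambda> by (auto intro: G_ge G_le)
      then show "\<bar>?f \<omega> - G \<Lambda> ?f \<omega>\<bar> \<le> 1" by (auto simp: abs_le_iff)
    next
      fix B assume "B \<in> cylinders N (- \<Lambda>)"
      then obtain P K where B: "B = {\<omega> \<in> configs N. P \<omega>}" "finite K" "K \<subseteq> - \<Lambda>" "depends_on P K"
        by (rule cylindersE)
      let ?g = "\<lambda>\<omega>. of_bool (P \<omega>) :: real"
      have g: "depends_on ?g K" using B(4) by (rule depends_on_comp)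
      have gf: "integrable \<mu> (\<lambda>\<omega>. ?g \<omega> * ?f \<omega>)"
        using B(2) \<Lambda> by (intro intl[OF _ depends_on_comp2[OF g dep]]) auto
      have gG: "integrable \<mu> (\<lambda>\<omega>. ?g \<omega> * G \<Lambda> ?f \<omega>)"
        using B(2) finite_outer[OF \<Lambda>] by (intro intl[OF _ depends_on_comp2[OF g depG]]) auto
      have "(\<integral>\<omega>. indicator B \<omega> * (?f \<omega> - G \<Lambda> ?f \<omega>) \<partial>\<mu>) =
          (\<integral>\<omega>. ?g \<omega> * ?f \<omega> - ?g \<omega> * G \<Lambda> ?f \<omega> \<partial>\<mu>)"
        by (intro Bochner_Integration.integral_cong refl) (simp add: B(1) space_\<mu> indicator_def)
      also have "\<dots> = (\<integral>\<omega>. ?g \<omega> * ?f \<omega> \<partial>\<mu>) - (\<integral>\<omega>. ?g \<omega> * G \<Lambda> ?f \<omega> \<partial>\<mu>)"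
        using gf gG by (rule Bochner_Integration.integral_diff)
      also have "\<dots> = 0"
        using DLR_local[OF \<Lambda> \<Lambda> dep B(2) _ g] B(3) by (simp add: disjoint_eq_subset_Compl)
      finally show "(\<integral>\<omega>. indicator B \<omega> * (?f \<omega> - G \<Lambda> ?f \<omega>) \<partial>\<mu>) = 0" .
    qed
    then have "(\<integral>\<omega>. indicator A \<omega> * ?f \<omega> \<partial>\<mu>) = (\<integral>\<omega>. indicator A \<omega> * G \<Lambda> ?f \<omega> \<partial>\<mu>)"
      using intA[OF int(1)] intA[OF int(2)] by (simp add: right_diff_distrib)
    moreover have "(\<integral>\<omega>. indicator A \<omega> * ?f \<omega> \<partial>\<mu>) = (\<integral>\<omega>. indicator A \<omega> * ?C \<omega> \<partial>\<mu>)"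
      by (intro Bochner_Integration.integral_cong refl) (simp add: space_\<mu> C)
    ultimately show "(\<integral>\<omega>\<in>A. ?C \<omega> \<partial>\<mu>) = (\<integral>\<omega>\<in>A. G \<Lambda> ?f \<omega> \<partial>\<mu>)"
      by (simp add: set_lebesgue_integral_def)
  qed
  then show "AE \<omega> in \<mu>. real_cond_exp \<mu> ?F ?C \<omega> = exp (- H \<Lambda> (override_on \<omega> w \<Lambda>)) / Z \<Lambda> \<omega>"
    unfolding G_atom[OF \<Lambda> w] .
qed

end

section \<open>Uniqueness and \<open>\<psi>\<close>-mixing\<close>

lemma finite_sum_le_infsum_ennreal:
  fixes f :: "'a \<Rightarrow> ennreal"
  assumes "finite B" "B \<subseteq> A"
  shows "sum f B \<le> infsum f A"
proof -
  have "infsum f B \<le> infsum f A"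
    using assms by (intro infsum_mono_neutral nonneg_summable_on_complete) auto
  with assms show ?thesis by simp
qed

lemma finite_sum_le_exp_dist_sum:
  assumes "finite U'" "finite V'" "U' \<subseteq> U" "V' \<subseteq> V"
  shows "ennreal (\<Sum>t\<in>U'. \<Sum>s\<in>V'. exp (- r * real (graph_dist adj t s))) \<le> exp_dist_sum adj r U V"
proof -
  have "ennreal (\<Sum>t\<in>U'. \<Sum>s\<in>V'. exp (- r * real (graph_dist adj t s))) =
      (\<Sum>t\<in>U'. \<Sum>s\<in>V'. ennreal (exp (- r * real (graph_dist adj t s))))"
    by (simp add: sum_nonneg flip: sum_ennreal)
  also have "\<dots> \<le> (\<Sum>t\<in>U'. \<Sum>\<^sub>\<infinity>s\<in>V. ennreal (exp (- r * real (graph_dist adj t s))))"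
    using assms by (intro sum_mono finite_sum_le_infsum_ennreal)
  also have "\<dots> \<le> exp_dist_sum adj r U V"
    unfolding exp_dist_sum_def using assms by (intro finite_sum_le_infsum_ennreal)
  finally show ?thesis .
qed

context potts_limit begin

text \<open>Letting the larger volume in \<open>G_close\<close> exhaust the graph. The boundary
  condition \<open>\<omega>'\<close> stays arbitrary, so that any measure may be integrated over
  it.\<close>

lemma cylinder_limit_close:
  assumes "finite J" "depends_on P J" "\<And>s. s \<in> J \<Longrightarrow> ball_of s n \<subseteq> \<Lambda>" "finite \<Lambda>"
  shows "\<bar>measure \<mu> {\<omega> \<in> configs N. P \<omega>} - G \<Lambda> (\<lambda>\<omega>. of_bool (P \<omega>)) \<omega>'\<bar> \<le> card J * \<theta> ^ n"
proof -
  let ?g = "\<lambda>\<omega>. of_bool (P \<omega>) :: real"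
  have dep: "depends_on ?g J" using assms(2) by (rule depends_on_comp)
  have "(\<lambda>m. G (patch m) ?g ones) \<longlonglongrightarrow> measure \<mu> {\<omega> \<in> configs N. P \<omega>}"
    using integral_local_lim[OF assms(1) dep] unfolding integral_of_bool[OF space_\<mu>] .
  then have lim: "(\<lambda>m. \<bar>G (patch m) ?g ones - G \<Lambda> ?g \<omega>'\<bar>) \<longlonglongrightarrow>
      \<bar>measure \<mu> {\<omega> \<in> configs N. P \<omega>} - G \<Lambda> ?g \<omega>'\<bar>"
    by (intro tendsto_intros)
  have "\<forall>\<^sub>F m in sequentially. \<bar>G (patch m) ?g ones - G \<Lambda> ?g \<omega>'\<bar> \<le> card J * \<theta> ^ n"
    using patch_exhausts_set[OF assms(4)]
    by eventually_elim (rule G_close[OF finite_patch _ assms(1) dep], auto dest: assms(3))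
  with lim show ?thesis by (rule tendsto_upperbound) simp
qed

text \<open>The Gibbs condition speaks of full patterns on \<open>\<Lambda>\<close>. Integrating it
  and adding up the patterns that satisfy \<open>P\<close> expresses each local event inside
  \<open>\<Lambda>\<close> as an average of finite-volume probabilities.\<close>

lemma realizing_cylinder:
  assumes \<nu>: "realizing_gibbs N (potts_potential adj \<beta>) \<nu>"
    and J: "finite J" "depends_on P J" and \<Lambda>: "finite \<Lambda>" "J \<subseteq> \<Lambda>"
  shows "measure \<nu> {\<omega> \<in> configs N. P \<omega>} = (\<integral>\<omega>. G \<Lambda> (\<lambda>\<omega>. of_bool (P \<omega>)) \<omega> \<partial>\<nu>)"
proof -
  from \<nu> have ps: "prob_space \<nu>" and sp: "space \<nu> = configs N" and st: "sets \<nu> = sets (config_borel N)"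
    and cond: "\<And>w. w \<in> cfg \<Lambda> \<Longrightarrow> AE \<omega> in \<nu>. real_cond_exp \<nu> (config_algebra N (- \<Lambda>))
        (indicator {\<eta> \<in> configs N. restrict \<eta> \<Lambda> = w}) \<omega>
      = exp (- H \<Lambda> (override_on \<omega> w \<Lambda>)) / Z \<Lambda> \<omega>"
    using \<Lambda> unfolding realizing_gibbs_def by blast+
  interpret \<nu>: prob_space \<nu> by (rule ps)
  note intl = local_integrable[OF ps sp st]
  have subalg: "subalgebra \<nu> (config_algebra N U)" for U
    using config_algebra_subset sp st by (auto simp: subalgebra_def)
  interpret F: sigma_finite_subalgebra \<nu> "config_algebra N (- \<Lambda>)"
    using subalg by (intro finite_measure_subalgebra_is_sigma_finite)
      (unfold_locales, auto)
  let ?p = "\<lambda>w \<eta>. of_bool (\<forall>t\<in>\<Lambda>. \<eta> t = w t) :: real"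
  let ?g = "\<lambda>\<omega>. of_bool (P \<omega>) :: real"
  have dep: "depends_on (?p w) \<Lambda>" for w by (rule depends_on_comp[OF depends_on_pattern])
  have depG: "depends_on (G \<Lambda> (?p w)) (outer \<Lambda>)" for w using depends_on_G[OF \<Lambda>(1) dep] by simp
  have depP: "depends_on ?g \<Lambda>" using depends_on_mono[OF depends_on_comp[OF J(2)] \<Lambda>(2)] .
  have atom: "measure \<nu> {\<omega> \<in> configs N. \<forall>t\<in>\<Lambda>. \<omega> t = w t} = (\<integral>\<omega>. G \<Lambda> (?p w) \<omega> \<partial>\<nu>)" if w: "w \<in> cfg \<Lambda>" for w
  proof -
    let ?C = "{\<omega> \<in> configs N. restrict \<omega> \<Lambda> = w}"
    have C: "?C = {\<omega> \<in> configs N. \<forall>t\<in>\<Lambda>. \<omega> t = w t}" by (simp only: restrict_eq_iff[OF w])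
    have "?C \<in> sets \<nu>"
      unfolding C using cylinder_in_config_algebra[OF depends_on_pattern \<Lambda>(1), of UNIV N w]
        config_algebra_subset[of UNIV] st by auto
    then have "measure \<nu> ?C = (\<integral>\<omega>. indicator ?C \<omega> \<partial>\<nu>)" and int: "integrable \<nu> (indicator ?C :: _ \<Rightarrow> real)"
      using sets.sets_into_space by (auto simp: Int_absorb2 \<nu>.emeasure_eq_measure)
    note this(1)
    also have "(\<integral>\<omega>. indicator ?C \<omega> \<partial>\<nu>) = (\<integral>\<omega>. real_cond_exp \<nu> (config_algebra N (- \<Lambda>)) (indicator ?C) \<omega> \<partial>\<nu>)"
      using F.real_cond_exp_int(2)[OF int] by simp
    also have "\<dots> = (\<integral>\<omega>. G \<Lambda> (?p w) \<omega> \<partial>\<nu>)"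
    proof (rule integral_cong_AE)
      show "AE \<omega> in \<nu>. real_cond_exp \<nu> (config_algebra N (- \<Lambda>)) (indicator ?C) \<omega> = G \<Lambda> (?p w) \<omega>"
        using cond[OF w] unfolding G_atom[OF \<Lambda>(1) w] .
      show "G \<Lambda> (?p w) \<in> borel_measurable \<nu>"
        using intl[OF finite_outer[OF \<Lambda>(1)] depG] by simp
    qed (use F.real_cond_exp_int(1)[OF int] in simp)
    finally show ?thesis unfolding C .
  qed
  have "measure \<nu> {\<omega> \<in> configs N. P \<omega>} = (\<integral>\<omega>. ?g \<omega> \<partial>\<nu>)"
    by (rule integral_of_bool[OF sp, symmetric])
  also have "\<dots> = (\<Sum>w\<in>cfg \<Lambda>. ?g w * (\<integral>\<omega>. G \<Lambda> (?p w) \<omega> \<partial>\<nu>))"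
    unfolding integral_local_eq_sum[OF ps sp st \<Lambda>(1) depP] by (intro sum.cong refl) (simp add: atom)
  also have "\<dots> = (\<integral>\<omega>. (\<Sum>w\<in>cfg \<Lambda>. ?g w * G \<Lambda> (?p w) \<omega>) \<partial>\<nu>)"
    using intl[OF finite_outer[OF \<Lambda>(1)] depG] by (simp add: Bochner_Integration.integral_sum)
  also have "\<dots> = (\<integral>\<omega>. G \<Lambda> ?g \<omega> \<partial>\<nu>)"
  proof (intro Bochner_Integration.integral_cong refl)
    fix \<omega> assume "\<omega> \<in> space \<nu>"
    then have \<omega>: "\<omega> \<in> configs N" by (simp add: sp)
    have "G \<Lambda> ?g \<omega> = G \<Lambda> (\<lambda>\<eta>. \<Sum>w\<in>cfg \<Lambda>. ?g w * ?p w \<eta>) \<omega>"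
      by (intro G_cong local_decomposition[OF \<Lambda>(1) depP] override_in_configs[OF \<omega>])
    then show "(\<Sum>w\<in>cfg \<Lambda>. ?g w * G \<Lambda> (?p w) \<omega>) = G \<Lambda> ?g \<omega>"
      by (simp only: G_sum G_cmult)
  qed
  finally show ?thesis .
qed

text \<open>Under \<open>\<nu>\<close> a cylinder has the average of its finite-volume probabilities
  over random boundary conditions, and all of these are within a vanishing error of its probability
  under \<open>\<mu>\<close>. Cylinders are closed under intersection and generate.\<close>

lemma uniqueness:
  assumes \<nu>: "realizing_gibbs N (potts_potential adj \<beta>) \<nu>"
  shows "\<nu> = \<mu>"
proof -
  from \<nu> have ps: "prob_space \<nu>" and sp: "space \<nu> = configs N" and st: "sets \<nu> = sets (config_borel N)"
    by (auto simp: realizing_gibbs_def)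
  interpret \<nu>: prob_space \<nu> by (rule ps)
  have eq: "measure \<nu> A = measure \<mu> A" if cyl: "A \<in> cylinders N UNIV" for A
  proof (rule ccontr)
    assume ne: "measure \<nu> A \<noteq> measure \<mu> A"
    obtain P J where A: "A = {\<omega> \<in> configs N. P \<omega>}" "finite J" "depends_on P J"
      using cyl by (rule cylindersE)
    obtain n where n: "card J * \<theta> ^ n < \<bar>measure \<nu> A - measure \<mu> A\<bar>"
      using influence_small ne by (metis right_minus_eq zero_less_abs_iff)
    obtain M where M: "\<forall>s\<in>J. ball_of s n \<subseteq> patch M" using patch_exhausts[OF A(2)] by blast
    let ?g = "\<lambda>\<omega>. of_bool (P \<omega>) :: real"
    have sub: "J \<subseteq> patch M" using M self_in_ball by blast
    have close: "\<bar>measure \<mu> A - G (patch M) ?g \<omega>\<bar> \<le> card J * \<theta> ^ n" for \<omega>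
      unfolding A(1) using M A finite_patch by (intro cylinder_limit_close) auto
    have "depends_on ?g J" using A(3) by (rule depends_on_comp)
    then have int: "integrable \<nu> (G (patch M) ?g)"
      using A(2) finite_outer[OF finite_patch] finite_patch
      by (intro local_integrable[OF ps sp st _ depends_on_G]) auto
    have "measure \<nu> A = (\<integral>\<omega>. G (patch M) ?g \<omega> \<partial>\<nu>)"
      unfolding A(1) using \<nu> A(2,3) finite_patch sub by (rule realizing_cylinder)
    moreover have "(\<integral>\<omega>. G (patch M) ?g \<omega> \<partial>\<nu>) \<le> measure \<mu> A + card J * \<theta> ^ n"
      using close by (intro \<nu>.integral_le_const[OF int] AE_I2) (smt (verit))
    moreover have "measure \<mu> A - card J * \<theta> ^ n \<le> (\<integral>\<omega>. G (patch M) ?g \<omega> \<partial>\<nu>)"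
      using close by (intro \<nu>.integral_ge_const[OF int] AE_I2) (smt (verit))
    ultimately show False using n by linarith
  qed
  interpret algebra "configs N" "cylinders N (UNIV :: 'v set)" by (rule algebra_cylinders)
  show ?thesis
  proof (rule measure_eqI_generator_eq[where A = "\<lambda>_. configs N"])
    show "Int_stable (cylinders N (UNIV :: 'v set))" by (auto simp: Int_stable_def)
    show "emeasure \<nu> A = emeasure \<mu> A" if "A \<in> cylinders N UNIV" for A
      using eq[OF that] by (simp add: \<nu>.emeasure_eq_measure emeasure_eq_measure)
    show "sets \<nu> = sigma_sets (configs N) (cylinders N UNIV)" "sets \<mu> = sigma_sets (configs N) (cylinders N UNIV)"
      using st sets_\<mu> sets_config_borel[OF countable_vertices] by auto
    show "range (\<lambda>_. configs N) \<subseteq> cylinders N (UNIV :: 'v set)" by auto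
    show "emeasure \<nu> (configs N) \<noteq> \<infinity>" by simp
  qed (use space_closed in auto)
qed

section \<open>Mixing in terms of the graph distance\<close>

lemma graph_dist_commute: "graph_dist adj s t = graph_dist adj t s"
proof -
  have "(adj ^^ n) s t \<Longrightarrow> (adj ^^ n) t s" for n s t
  proof (induction n arbitrary: t)
    case (Suc n)
    then obtain u where "(adj ^^ n) s u" "adj u t" by auto
    with Suc.IH adj_sym show ?case by (blast intro: relpowp_Suc_I2)
  qed simp
  then have "(adj ^^ n) s t \<longleftrightarrow> (adj ^^ n) t s" for n by blast
  then show ?thesis by (simp add: graph_dist_def)
qed

lemma graph_dist_le: "t \<in> ball_of s n \<Longrightarrow> graph_dist adj s t \<le> n"
  by (auto simp: ball_of_def graph_dist_def intro: Least_le order_trans)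

lemma graph_dist_pos: "s \<noteq> t \<Longrightarrow> graph_dist adj s t > 0"
  using LeastI_ex[OF walk_exists[of s t]] by (cases "graph_dist adj s t") (auto simp: graph_dist_def)

text \<open>The finite-volume bound is uniform once the patch contains \<open>V\<close>, and each of
  its terms is the expectation of a local function, so it survives the limit.\<close>

lemma mixing_cylinders:
  assumes r: "\<theta> \<le> exp (- r)"
    and U: "finite U" "depends_on P U" and V: "finite V" "depends_on Q V" and disj: "U \<inter> V = {}"
    and small: "(\<Sum>t\<in>U. \<Sum>s\<in>V. exp (- r * graph_dist adj t s)) / (\<theta> * p_min) \<le> 1"
  defines "A \<equiv> {\<omega> \<in> configs N. P \<omega>}" and "B \<equiv> {\<omega> \<in> configs N. Q \<omega>}"
  shows "\<bar>measure \<mu> (A \<inter> B) - measure \<mu> A * measure \<mu> B\<bar> \<le>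
    2 * ((\<Sum>t\<in>U. \<Sum>s\<in>V. exp (- r * graph_dist adj t s)) / (\<theta> * p_min)) * (measure \<mu> A * measure \<mu> B)"
proof -
  let ?f = "\<lambda>\<omega>. of_bool (P \<omega>) :: real" and ?g = "\<lambda>\<omega>. of_bool (Q \<omega>) :: real"
  let ?S = "(\<Sum>t\<in>U. \<Sum>s\<in>V. exp (- r * graph_dist adj t s)) / (\<theta> * p_min)"
  \<comment> \<open>The allowance of site \<open>s\<close>. Dividing by \<open>p_min\<close> pays
    for Bayes' rule; dividing by \<open>\<theta>\<close> pays for the radius, since the largest ball
    around \<open>s\<close> that misses \<open>U\<close> has radius one less than the
    distance.\<close>
  define \<epsilon> where "\<epsilon> s = (\<Sum>t\<in>U. exp (- r * graph_dist adj t s)) / (\<theta> * p_min)" for s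
  have sum_\<epsilon>: "(\<Sum>s\<in>V. \<epsilon> s) = ?S"
    unfolding \<epsilon>_def sum_divide_distrib[symmetric] by (subst sum.swap) simp
  have \<epsilon>_nonneg: "\<epsilon> s \<ge> 0" for s
    unfolding \<epsilon>_def using \<theta>_pos p_min_pos by (intro divide_nonneg_pos sum_nonneg) auto
  have sum1: "(\<Sum>s\<in>V. \<epsilon> s) \<le> 1" unfolding sum_\<epsilon> by (rule small)
  have far: "U = {} \<or> (\<exists>n. U \<inter> ball_of s n = {} \<and> \<theta> ^ n \<le> \<epsilon> s * p_min)" if "s \<in> V" for s
  proof (cases "U = {}")
    case False
    obtain t where t: "t \<in> U" "\<And>u. u \<in> U \<Longrightarrow> graph_dist adj s t \<le> graph_dist adj s u"
      using ex_min_if_finite[of "graph_dist adj s ` U"] U(1) False by (force simp: not_less)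
    have "s \<noteq> t" using disj that t(1) by auto
    then have pos: "graph_dist adj s t > 0" by (rule graph_dist_pos)
    define n where "n = graph_dist adj s t - 1"
    have n: "graph_dist adj s t = Suc n" using pos by (simp add: n_def)
    have "U \<inter> ball_of s n = {}"
    proof (rule ccontr)
      assume "U \<inter> ball_of s n \<noteq> {}"
      then obtain u where "u \<in> U" "u \<in> ball_of s n" by blast
      with t(2)[of u] graph_dist_le[of u s n] n show False by linarith
    qed
    moreover have "\<theta> ^ n \<le> \<epsilon> s * p_min"
    proof -
      have "\<theta> ^ Suc n \<le> exp (- r) ^ Suc n" using r \<theta>_pos by (intro power_mono) auto
      also have "\<dots> = exp (- r * graph_dist adj t s)"
        unfolding exp_of_nat_mult[symmetric] graph_dist_commute[of t s] n by (simp add: mult.commute)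
      \<comment> \<open>The nearest site of \<open>U\<close> alone accounts for the influence; the
        other terms only enlarge the allowance.\<close>
      also have "\<dots> \<le> (\<Sum>t\<in>U. exp (- r * graph_dist adj t s))"
        using U(1) t(1) by (intro member_le_sum) auto
      finally show ?thesis using \<theta>_pos p_min_pos by (simp add: \<epsilon>_def field_simps)
    qed
    ultimately show ?thesis by blast
  qed simp
  have dep: "depends_on ?f U" "depends_on ?g V" using U(2) V(2) by (auto intro: depends_on_comp)
  have A: "(\<lambda>m. G (patch m) ?f ones) \<longlonglongrightarrow> measure \<mu> A"
    unfolding A_def integral_of_bool[OF space_\<mu>, symmetric] by (rule integral_local_lim[OF U(1) dep(1)])
  have B: "(\<lambda>m. G (patch m) ?g ones) \<longlonglongrightarrow> measure \<mu> B"
    unfolding B_def integral_of_bool[OF space_\<mu>, symmetric] by (rule integral_local_lim[OF V(1) dep(2)])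
  have "A \<inter> B = {\<omega> \<in> configs N. Q \<omega> \<and> P \<omega>}" by (auto simp: A_def B_def)
  then have "measure \<mu> (A \<inter> B) = (\<integral>\<omega>. ?g \<omega> * ?f \<omega> \<partial>\<mu>)"
    by (simp add: integral_of_bool[OF space_\<mu>] flip: of_bool_conj)
  then have AB: "(\<lambda>m. G (patch m) (\<lambda>\<omega>. ?g \<omega> * ?f \<omega>) ones) \<longlonglongrightarrow> measure \<mu> (A \<inter> B)"
    using integral_local_lim[OF _ depends_on_comp2[OF dep(2,1)]] U(1) V(1) by simp
  have "\<forall>\<^sub>F m in sequentially.
      \<bar>G (patch m) (\<lambda>\<omega>. ?g \<omega> * ?f \<omega>) ones - G (patch m) ?g ones * G (patch m) ?f ones\<bar>
      \<le> 2 * ?S * (G (patch m) ?g ones * G (patch m) ?f ones)"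
    using patch_exhausts_set[OF V(1)]
  proof eventually_elim
    case (elim m)
    show ?case unfolding sum_\<epsilon>[symmetric]
      using V(1) finite_patch elim disj dep(1) _ dep(2) _ ones_in_configs \<epsilon>_nonneg sum1 far
      by (rule mixing_finite) simp_all
  qed
  moreover have "(\<lambda>m. \<bar>G (patch m) (\<lambda>\<omega>. ?g \<omega> * ?f \<omega>) ones - G (patch m) ?g ones * G (patch m) ?f ones\<bar>)
      \<longlonglongrightarrow> \<bar>measure \<mu> (A \<inter> B) - measure \<mu> B * measure \<mu> A\<bar>"
    by (intro tendsto_rabs tendsto_diff tendsto_mult A B AB)
  moreover have "(\<lambda>m. 2 * ?S * (G (patch m) ?g ones * G (patch m) ?f ones))
      \<longlonglongrightarrow> 2 * ?S * (measure \<mu> B * measure \<mu> A)"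
    by (intro tendsto_mult_left tendsto_mult A B)
  ultimately have "\<bar>measure \<mu> (A \<inter> B) - measure \<mu> B * measure \<mu> A\<bar> \<le> 2 * ?S * (measure \<mu> B * measure \<mu> A)"
    by (intro tendsto_le[OF trivial_limit_sequentially])
  then show ?thesis by (simp only: mult.commute[of "measure \<mu> A"])
qed

lemma psi_mixing:
  assumes "r > 0" and r: "\<theta> \<le> exp (- r)"
  shows "psi_mixing adj N \<mu> r"
  unfolding psi_mixing_def
proof (intro conjI)
  define K where "K = 1 / (\<theta> * p_min)"
  \<comment> \<open>The 2 is the factor in \<open>mixing_cylinders\<close>, and the maximum with 1
    meets the requirement on the constant. \<open>C\<close> does not depend on \<open>U\<close> or
    \<open>V\<close>.\<close>
  define C where "C = max 1 (2 * K)"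
  have K: "K > 0" using \<theta>_pos p_min_pos by (simp add: K_def)
  have C1: "C \<ge> 1" and CK: "2 * K \<le> C" by (auto simp: C_def)
  show "\<exists>C\<ge>1. \<forall>U V. ennreal C * exp_dist_sum adj r U V < 1 \<longrightarrow>
      psi_coeff N \<mu> U V \<le> ennreal C * exp_dist_sum adj r U V"
  proof (rule exI[of _ C], intro conjI C1 allI impI)
    fix U V assume small: "ennreal C * exp_dist_sum adj r U V < 1"
    have "exp_dist_sum adj r U V \<noteq> \<top>" using small C1 by (auto simp: ennreal_mult_top)
    then obtain S where S: "S \<ge> 0" "exp_dist_sum adj r U V = ennreal S"
      by (cases "exp_dist_sum adj r U V") auto
    have CS: "C * S < 1"
      using small C1 S by (simp add: ennreal_mult[symmetric] ennreal_less_one_iff)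
    have fin_sum: "(\<Sum>t\<in>U'. \<Sum>s\<in>V'. exp (- r * graph_dist adj t s)) \<le> S"
      if "finite U'" "finite V'" "U' \<subseteq> U" "V' \<subseteq> V" for U' V'
      using finite_sum_le_exp_dist_sum[OF that, of r adj] S by (simp add: sum_nonneg)
    \<comment> \<open>A common site is at distance 0 from itself and contributes a full 1 to the
      sum, so smallness of the sum forces disjointness.\<close>
    have disj: "U \<inter> V = {}"
    proof (rule ccontr)
      assume "U \<inter> V \<noteq> {}"
      then obtain t where "t \<in> U" "t \<in> V" by blast
      moreover have "graph_dist adj t t = 0" unfolding graph_dist_def by (intro Least_eq_0) simp
      ultimately have "1 \<le> S" using fin_sum[of "{t}" "{t}"] by simp
      then have "1 \<le> C * S" using C1 mult_mono[of 1 C 1 S] by simp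
      with CS show False by simp
    qed
    have cyl: "\<bar>measure \<mu> (A \<inter> B) - measure \<mu> A * measure \<mu> B\<bar> \<le> C * S * (measure \<mu> A * measure \<mu> B)"
      if cA: "A \<in> cylinders N U" and cB: "B \<in> cylinders N V" for A B
    proof -
      obtain P U' where A: "A = {\<omega> \<in> configs N. P \<omega>}" "finite U'" "U' \<subseteq> U" "depends_on P U'"
        using cA by (rule cylindersE)
      obtain Q V' where B: "B = {\<omega> \<in> configs N. Q \<omega>}" "finite V'" "V' \<subseteq> V" "depends_on Q V'"
        using cB by (rule cylindersE)
      define T where "T = (\<Sum>t\<in>U'. \<Sum>s\<in>V'. exp (- r * graph_dist adj t s)) / (\<theta> * p_min)"
      have "T = K * (\<Sum>t\<in>U'. \<Sum>s\<in>V'. exp (- r * graph_dist adj t s))" by (simp add: T_def K_def)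
      also have "\<dots> \<le> K * S" using fin_sum[OF A(2) B(2) A(3) B(3)] K by simp
      finally have "2 * T \<le> (2 * K) * S" by simp
      also have "\<dots> \<le> C * S" using CK S(1) by (rule mult_right_mono)
      finally have T: "2 * T \<le> C * S" .
      have "\<bar>measure \<mu> (A \<inter> B) - measure \<mu> A * measure \<mu> B\<bar> \<le> 2 * T * (measure \<mu> A * measure \<mu> B)"
        unfolding A(1) B(1) T_def using r A(2,4) B(2,4)
      proof (rule mixing_cylinders)
        show "U' \<inter> V' = {}" using A B disj by auto
        show "(\<Sum>t\<in>U'. \<Sum>s\<in>V'. exp (- r * graph_dist adj t s)) / (\<theta> * p_min) \<le> 1"
          using T CS by (simp add: T_def)
      qed
      also have "\<dots> \<le> C * S * (measure \<mu> A * measure \<mu> B)" using T by (intro mult_right_mono) auto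
      finally show ?thesis .
    qed
    \<comment> \<open>The approximating cylinders are taken within the sigma-algebras of
      \<open>U\<close> and \<open>V\<close> themselves, so the same \<open>S\<close> bounds every
      approximation, and both sides are continuous under approximation in measure.\<close>
    have ineq: "\<bar>measure \<mu> (A \<inter> B) - measure \<mu> A * measure \<mu> B\<bar> \<le> C * S * (measure \<mu> A * measure \<mu> B)"
      if A: "A \<in> sets (config_algebra N U)" and B: "B \<in> sets (config_algebra N V)" for A B
    proof -
      have "\<exists>X\<in>cylinders N U. measure \<mu> (sym_diff A X) < 1 / Suc n" for n
        using A by (rule approx_by_cylinder) simp
      then obtain X where X: "\<And>n. X n \<in> cylinders N U" "\<And>n. measure \<mu> (sym_diff A (X n)) < 1 / Suc n"
        by metis
      have "\<exists>Y\<in>cylinders N V. measure \<mu> (sym_diff B Y) < 1 / Suc n" for n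
        using B by (rule approx_by_cylinder) simp
      then obtain Y where Y: "\<And>n. Y n \<in> cylinders N V" "\<And>n. measure \<mu> (sym_diff B (Y n)) < 1 / Suc n"
        by metis
      have sets: "A \<in> sets \<mu>" "B \<in> sets \<mu>" "\<And>n. X n \<in> sets \<mu>" "\<And>n. Y n \<in> sets \<mu>"
        using A B X(1) Y(1) by (auto intro: config_algebra_sets cylinder_sets)
      have diff: "\<bar>measure \<mu> S - measure \<mu> T\<bar> \<le> measure \<mu> (sym_diff S T)"
        if "S \<in> sets \<mu>" "T \<in> sets \<mu>" for S T
      proof -
        have "measure \<mu> S \<le> measure \<mu> (T \<union> sym_diff S T)" "measure \<mu> T \<le> measure \<mu> (S \<union> sym_diff S T)"
          using that by (intro finite_measure_mono; auto)+
        moreover have "measure \<mu> (T \<union> sym_diff S T) \<le> measure \<mu> T + measure \<mu> (sym_diff S T)"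
          "measure \<mu> (S \<union> sym_diff S T) \<le> measure \<mu> S + measure \<mu> (sym_diff S T)"
          using that by (intro measure_Un_le; auto)+
        ultimately show ?thesis by linarith
      qed
      have null: "(\<lambda>n. 2 * (1 / real (Suc n))) \<longlonglongrightarrow> 0"
        using tendsto_mult_left[OF LIMSEQ_Suc[OF lim_1_over_n], of 2] by simp
      \<comment> \<open>The tolerance is dictated by the intersection, which collects one error from
        each of the two sets.\<close>
      have conv: "(\<lambda>n. measure \<mu> (T n)) \<longlonglongrightarrow> measure \<mu> S"
        if "\<And>n. \<bar>measure \<mu> S - measure \<mu> (T n)\<bar> \<le> 2 * (1 / real (Suc n))" for S T
      proof (rule LIM_zero_cancel, rule Lim_null_comparison[OF _ null])
        show "\<forall>\<^sub>F n in sequentially. norm (measure \<mu> (T n) - measure \<mu> S) \<le> 2 * (1 / real (Suc n))"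
          using that unfolding real_norm_def by (subst abs_minus_commute) (rule always_eventually, blast)
      qed
      have cA: "(\<lambda>n. measure \<mu> (X n)) \<longlonglongrightarrow> measure \<mu> A"
      proof (rule conv)
        fix n
        have "0 \<le> 1 / real (Suc n)" by simp
        then show "\<bar>measure \<mu> A - measure \<mu> (X n)\<bar> \<le> 2 * (1 / real (Suc n))"
          using diff[OF sets(1) sets(3)[of n]] X(2)[of n] by linarith
      qed
      have cB: "(\<lambda>n. measure \<mu> (Y n)) \<longlonglongrightarrow> measure \<mu> B"
      proof (rule conv)
        fix n
        have "0 \<le> 1 / real (Suc n)" by simp
        then show "\<bar>measure \<mu> B - measure \<mu> (Y n)\<bar> \<le> 2 * (1 / real (Suc n))"
          using diff[OF sets(2) sets(4)[of n]] Y(2)[of n] by linarith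
      qed
      have cAB: "(\<lambda>n. measure \<mu> (X n \<inter> Y n)) \<longlonglongrightarrow> measure \<mu> (A \<inter> B)"
      proof (rule conv)
        fix n
        have "\<bar>measure \<mu> (A \<inter> B) - measure \<mu> (X n \<inter> Y n)\<bar> \<le> measure \<mu> (sym_diff (A \<inter> B) (X n \<inter> Y n))"
          using sets by (intro diff) auto
        also have "\<dots> \<le> measure \<mu> (sym_diff A (X n) \<union> sym_diff B (Y n))"
          using sets by (intro finite_measure_mono) auto
        also have "\<dots> \<le> measure \<mu> (sym_diff A (X n)) + measure \<mu> (sym_diff B (Y n))"
          using sets by (intro measure_Un_le) auto
        finally show "\<bar>measure \<mu> (A \<inter> B) - measure \<mu> (X n \<inter> Y n)\<bar> \<le> 2 * (1 / real (Suc n))"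
          using X(2)[of n] Y(2)[of n] by linarith
      qed
      show ?thesis
      proof (rule LIMSEQ_le)
        show "(\<lambda>n. \<bar>measure \<mu> (X n \<inter> Y n) - measure \<mu> (X n) * measure \<mu> (Y n)\<bar>) \<longlonglongrightarrow>
            \<bar>measure \<mu> (A \<inter> B) - measure \<mu> A * measure \<mu> B\<bar>"
          by (intro tendsto_intros cA cB cAB)
        show "(\<lambda>n. C * S * (measure \<mu> (X n) * measure \<mu> (Y n))) \<longlonglongrightarrow> C * S * (measure \<mu> A * measure \<mu> B)"
          by (intro tendsto_intros cA cB)
      qed (use cyl X(1) Y(1) in blast)
    qed
    have bound: "\<bar>measure \<mu> (A \<inter> B) / (measure \<mu> A * measure \<mu> B) - 1\<bar> \<le> C * S"
      if "A \<in> sets (config_algebra N U)" "B \<in> sets (config_algebra N V)" "measure \<mu> A * measure \<mu> B > 0" for A B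
    proof -
      have "measure \<mu> (A \<inter> B) / (measure \<mu> A * measure \<mu> B) - 1 =
          (measure \<mu> (A \<inter> B) - measure \<mu> A * measure \<mu> B) / (measure \<mu> A * measure \<mu> B)"
        using that(3) by (simp only: diff_divide_distrib) auto
      then show ?thesis using ineq[OF that(1,2)] that(3) by (simp add: abs_divide pos_divide_le_eq)
    qed
    have "psi_coeff N \<mu> U V \<le> ennreal (C * S)"
      unfolding psi_coeff_def by (rule Sup_least) (auto intro!: ennreal_leI bound)
    then show "psi_coeff N \<mu> U V \<le> ennreal C * exp_dist_sum adj r U V"
      using C1 S by (simp add: ennreal_mult)
  qed
qed (fact assms(1))

end

theorem corollary4p4:
  fixes adj :: "'v \<Rightarrow> 'v \<Rightarrow> bool" and d N :: nat and \<beta> :: real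
  assumes "d > 2"
    and "regular_tree d adj"
    and "N > 2 * d ^ 4 + d"
    and "\<beta> > 0"
  shows "\<exists>\<mu>. realizing_gibbs N (potts_potential adj \<beta>) \<mu> \<and>
             (\<forall>\<nu>. realizing_gibbs N (potts_potential adj \<beta>) \<nu> \<longrightarrow> \<nu> = \<mu>) \<and>
             psi_mixing adj N \<mu> (1 / 9 * ln (real N - real d) - 4 / 9 * ln (real d) - ln 2 / 9)"
proof -
  define x where "x = real N - real d"
  define r where "r = 1 / 9 * ln (real N - real d) - 4 / 9 * ln (real d) - ln 2 / 9"
  have d: "real d \<ge> 1" using assms(1) by simp
  have "real (2 * d ^ 4 + d) < real N" using assms(3) by (simp only: of_nat_less_iff)
  then have x: "2 * real d ^ 4 < x" by (simp add: x_def)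
  have x_pos: "x > 0" using x d by (smt (verit) zero_le_power)
  have d4: "2 * real d ^ 4 > 0" using d by simp
  \<comment> \<open>Nine times the rate is \<open>ln ((N - d) / (2 * d ^ 4))\<close>, so the
    assumption on \<open>N\<close> says precisely that the rate is positive. Then
    \<open>\<theta> \<le> exp (- (9 * r)) \<le> exp (- r)\<close>, which gives both
    \<open>\<theta> < 1\<close> and the hypothesis of \<open>psi_mixing\<close>.\<close>
  have r_eq: "9 * r = ln (x / (2 * real d ^ 4))"
    using d d4 x x_pos unfolding r_def x_def[symmetric] by (simp add: ln_div ln_mult ln_realpow)
  have "x / (2 * real d ^ 4) > 1" using x d4 by simp
  then have "9 * r > 0" unfolding r_eq by (rule ln_gt_zero)
  then have r_pos: "r > 0" by simp
  interpret potts adj d N \<beta>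
    using assms by unfold_locales (auto simp: regular_tree_def tree_graph_def)
  have "\<theta> \<le> 2 * real d ^ 4 / x"
  proof -
    have "real d ^ 2 \<le> real d ^ 4" using d by (intro power_increasing) auto
    then have "real d ^ 2 \<le> 2 * real d ^ 4" using d4 by linarith
    then show ?thesis unfolding \<theta>_def x_def[symmetric] using x_pos by (intro divide_right_mono) auto
  qed
  also have "\<dots> = exp (- (9 * r))" unfolding r_eq exp_minus using x_pos d4 by (subst exp_ln) (auto intro: divide_pos_pos)
  also have "\<dots> \<le> exp (- r)" using r_pos by simp
  finally have \<theta>_le: "\<theta> \<le> exp (- r)" .
  interpret potts_unique adj d N \<beta>
  proof
    show "connected_graph adj" using assms(2) by (simp add: regular_tree_def tree_graph_def)
    have "exp (- r) < 1" using r_pos by simp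
    with \<theta>_le show "\<theta> < 1" by linarith
  qed
  obtain \<mu> where \<mu>: "prob_space \<mu>" "space \<mu> = configs N" "sets \<mu> = sets (config_borel N)"
    "\<And>A. A \<in> cylinders N UNIV \<Longrightarrow> (\<lambda>m. G (patch m) (indicator A) ones) \<longlonglongrightarrow> measure \<mu> A"
    using exists_limit_measure by blast
  interpret \<mu>: prob_space \<mu> by (rule \<mu>(1))
  interpret potts_limit adj d N \<beta> \<mu> using \<mu> by unfold_locales auto
  show ?thesis
    using realizing uniqueness psi_mixing[OF r_pos \<theta>_le] unfolding r_def by blast
qed

end
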